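(* Let $n,s$ be integers satisfying $s\leq \frac{n}{2^{17}\log n}$. Let $\mathcal{F}\subset \mathcal D_n$ be a family of derangements such that $\nu(\mathcal{F})<s$. Then $|\mathcal{F}|\leq (s-1)d_{n,1}$. Moreover, in the case of equality, $\mathcal{F}$ is of the form $\bigcup_{i=1}^{s-1}\mathcal D_n[(x,y_i)]$ or $\bigcup_{i=1}^{s-1}\mathcal D_n[(x_i,y)]$, where the $y_i$'s, respectively the $x_i$'s, are distinct and all the pairs $(x,y_i)$, respectively $(x_i,y)$, are off-diagonal (i.e. have distinct coordinates).
   Context: $\Sigma_n$ is the set of permutations of $[n]$; a permutation is identified with its graph $\{(i,\sigma(i))\}\subset[n]^2$, two permutations intersect iff they agree at some point, and $\nu(\mathcal{F})$ is the maximum number of pairwise non-intersecting members of $\mathcal{F}$. $\mathcal D_n$ is the set of derangements (permutations with no fixed point). For a pair $(x,y)$, $\mathcal D_n[(x,y)]$ is the set of derangements $\pi$ with $\pi(x)=y$, and $d_{n,1}:=|\mathcal D_n[(x,y)]|$ for any $x\ne y$ (this does not depend on the choice of $x\neq y$). *)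

theory Defs
  imports "HOL-Combinatorics.Permutations" Complex_Main
begin

definition Sym :: "nat \<Rightarrow> (nat \<Rightarrow> nat) set" where
  "Sym n = {\<sigma>. \<sigma> permutes {1..n}}"

definition derangements :: "nat \<Rightarrow> (nat \<Rightarrow> nat) set" where
  "derangements n = {\<sigma>. \<sigma> permutes {1..n} \<and> (\<forall>i\<in>{1..n}. \<sigma> i \<noteq> i)}"

definition perm_intersect :: "nat \<Rightarrow> (nat \<Rightarrow> nat) \<Rightarrow> (nat \<Rightarrow> nat) \<Rightarrow> bool" where
  "perm_intersect n \<sigma> \<tau> \<longleftrightarrow> (\<exists>i\<in>{1..n}. \<sigma> i = \<tau> i)"

definition nu :: "nat \<Rightarrow> (nat \<Rightarrow> nat) set \<Rightarrow> nat" where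
  "nu n F = Max {card M | M. M \<subseteq> F \<and>
      (\<forall>\<sigma>\<in>M. \<forall>\<tau>\<in>M. \<sigma> \<noteq> \<tau> \<longrightarrow> \<not> perm_intersect n \<sigma> \<tau>)}"

definition derangements_at :: "nat \<Rightarrow> nat \<Rightarrow> nat \<Rightarrow> (nat \<Rightarrow> nat) set" where
  "derangements_at n x y = {\<pi> \<in> derangements n. \<pi> x = y}"

text \<open>d_{n,1} = |D_n[(x,y)]| for x \<noteq> y; we take (x,y) = (1,2).\<close>
definition d1 :: "nat \<Rightarrow> nat" where
  "d1 n = card (derangements_at n 1 2)"

end

theory Submission
  imports Defs "HOL-Library.Disjoint_Sets"
begin

text \<open>
  Permutations are viewed as \<open>n\<close>-element subsets of the grid. By the spread lemma, a random
  colouring of the grid shows that families that are \<open>r\<close>-spread with \<open>r\<close> of order \<open>s log n\<close>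
  contain pairwise disjoint representatives. Assign to every member of \<open>F\<close> greedily a core, i.e. a
  subset \<open>Y\<close> above which some subfamily of \<open>F\<close> is spread; then no \<open>s\<close> of the cores are pairwise
  disjoint. When a core of size \<open>j\<close> is chosen, all degrees are at most \<open>16 * 100 ^ (1 - j) * d1 n\<close>,
  so the cores with at least two elements contribute little: unless there are exactly \<open>s - 1\<close>
  singleton cores, \<open>F\<close> is too small. If there are \<open>s - 1\<close> of them and \<open>F\<close> is large, then the
  corresponding stars are almost full, and a further permutation \<open>\<sigma>\<close> outside these stars would
  extend to \<open>s\<close> pairwise disjoint members of \<open>F\<close>, because a constant proportion of the derangements
  through a given pair avoid \<open>\<sigma>\<close>. So \<open>F\<close> is contained in the union of \<open>s - 1\<close> stars, and equality
  forces these to be full and disjoint, which means that their centres lie in one row or in one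
  column.
\<close>

section \<open>Fragments\<close>

definition fragment :: "'a set set \<Rightarrow> 'a set \<Rightarrow> 'a set \<Rightarrow> 'a set" where
  "fragment \<A> W P = (ARG_MIN (\<lambda>Q. card (Q - W)) Q. Q \<in> \<A> \<and> Q \<subseteq> P \<union> W \<and> card Q \<le> card P) - W"

lemma fragment_minimal:
  assumes "P \<in> \<A>"
  obtains Q where "Q \<in> \<A>" "Q \<subseteq> P \<union> W" "card Q \<le> card P" "fragment \<A> W P = Q - W"
    "\<And>Q'. Q' \<in> \<A> \<Longrightarrow> Q' \<subseteq> P \<union> W \<Longrightarrow> card Q' \<le> card P \<Longrightarrow> card (Q - W) \<le> card (Q' - W)"
proof -
  let ?admissible = "\<lambda>Q. Q \<in> \<A> \<and> Q \<subseteq> P \<union> W \<and> card Q \<le> card P"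
  let ?Q = "arg_min (\<lambda>Q. card (Q - W)) ?admissible"
  have "?admissible P" using assms by auto
  then have "?admissible ?Q" by (rule arg_min_natI)
  moreover have "card (?Q - W) \<le> card (Q' - W)" if "?admissible Q'" for Q'
    using that by (rule arg_min_nat_le)
  ultimately show ?thesis using that[of ?Q] by (simp add: fragment_def)
qed

lemma fragment_subset:
  assumes "P \<in> \<A>"
  shows "fragment \<A> W P \<subseteq> P - W"
proof -
  obtain Q where "Q \<subseteq> P \<union> W" "fragment \<A> W P = Q - W"
    using assms by (rule fragment_minimal)
  then show ?thesis by auto
qed

definition smallest_within :: "'a set set \<Rightarrow> 'a set \<Rightarrow> 'a set" where
  "smallest_within \<A> W = (if \<exists>P\<in>\<A>. P \<subseteq> W then ARG_MIN card P. P \<in> \<A> \<and> P \<subseteq> W else {})"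

lemma smallest_within:
  assumes "P \<in> \<A>" "P \<subseteq> W"
  shows "smallest_within \<A> W \<in> \<A>" "smallest_within \<A> W \<subseteq> W"
    "card (smallest_within \<A> W) \<le> card P"
proof -
  let ?admissible = "\<lambda>Q. Q \<in> \<A> \<and> Q \<subseteq> W"
  let ?Q = "arg_min card ?admissible"
  have "?admissible P" using assms by simp
  then have "?admissible ?Q" "card ?Q \<le> card P"
    by (rule arg_min_natI, rule arg_min_nat_le)
  moreover have "smallest_within \<A> W = ?Q" using assms by (auto simp: smallest_within_def)
  ultimately show "smallest_within \<A> W \<in> \<A>" "smallest_within \<A> W \<subseteq> W"
    "card (smallest_within \<A> W) \<le> card P" by auto
qed

lemma smallest_within_subset_Union: "smallest_within \<A> W \<subseteq> \<Union>\<A>"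
proof (cases "\<exists>P\<in>\<A>. P \<subseteq> W")
  case True
  then show ?thesis using smallest_within(1) by blast
qed (simp add: smallest_within_def)

lemma fragment_subset_smallest_within:
  fixes \<A> :: "'a set set" and P W :: "'a set"
  assumes "P \<in> \<A>" "finite P"
  defines "Y \<equiv> fragment \<A> W P"
  shows "Y \<subseteq> smallest_within \<A> (W \<union> Y)" "card (smallest_within \<A> (W \<union> Y)) \<le> card P"
proof -
  let ?R = "smallest_within \<A> (W \<union> Y)"
  obtain Q where Q: "Q \<in> \<A>" "card Q \<le> card P" "Y = Q - W"
    and minimal: "\<And>Q'. Q' \<in> \<A> \<Longrightarrow> Q' \<subseteq> P \<union> W \<Longrightarrow> card Q' \<le> card P \<Longrightarrow> card (Q - W) \<le> card (Q' - W)"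
    using fragment_minimal[OF assms(1), of W] unfolding Y_def by metis
  have R: "?R \<in> \<A>" "?R \<subseteq> W \<union> Y" "card ?R \<le> card Q"
    using smallest_within[OF Q(1), of "W \<union> Y"] Q(3) by auto
  then show R_le: "card ?R \<le> card P" using Q(2) by simp
  have "Y \<subseteq> P" using fragment_subset[OF assms(1)] unfolding Y_def by blast
  then have "card Y \<le> card (?R - W)" "finite Y"
    using minimal[OF R(1) _ R_le] R(2) Q(3) assms(2) finite_subset by auto
  moreover have "?R - W \<subseteq> Y" using R(2) by auto
  ultimately have "?R - W = Y" by (metis card_seteq)
  then show "Y \<subseteq> ?R" by auto
qed

primrec fragments :: "'a set set \<Rightarrow> ('a \<Rightarrow> 'c) \<Rightarrow> 'c list \<Rightarrow> 'a set \<Rightarrow> 'a set" where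
  "fragments A \<chi> [] S = S"
| "fragments A \<chi> (c # cs) S = fragment (fragments A \<chi> cs ` A) (\<chi> -` {c}) (fragments A \<chi> cs S)"

lemma fragments_Cons_subset:
  "S \<in> A \<Longrightarrow> fragments A \<chi> (c # cs) S \<subseteq> fragments A \<chi> cs S - \<chi> -` {c}"
  by (simp add: fragment_subset)

lemma fragments_subset: "S \<in> A \<Longrightarrow> fragments A \<chi> cs S \<subseteq> S"
proof (induction cs)
  case (Cons c cs)
  then show ?case using fragments_Cons_subset by fast
qed simp

lemma fragments_avoid_colours: "S \<in> A \<Longrightarrow> x \<in> fragments A \<chi> cs S \<Longrightarrow> \<chi> x \<notin> set cs"
proof (induction cs)
  case (Cons c cs)
  then show ?case using fragments_Cons_subset[of S A \<chi> c cs] by auto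
qed simp

lemma fragments_cong:
  assumes "\<And>c. c \<in> set cs \<Longrightarrow> \<chi> -` {c} = \<chi>' -` {c}"
  shows "fragments A \<chi> cs = fragments A \<chi>' cs"
  using assms by (induction cs) (auto simp: fun_eq_iff)

lemma fragments_cover:
  assumes "S \<in> A"
  shows "\<exists>S'\<in>A. S' \<subseteq> fragments A \<chi> cs S \<union> \<chi> -` set cs"
  using assms
proof (induction cs arbitrary: S)
  case (Cons c cs)
  then have "fragments A \<chi> cs S \<in> fragments A \<chi> cs ` A" by blast
  then obtain P where "P \<in> fragments A \<chi> cs ` A" and P: "fragments A \<chi> (c # cs) S = P - \<chi> -` {c}"
    using fragment_minimal[of "fragments A \<chi> cs S" "fragments A \<chi> cs ` A" "\<chi> -` {c}"]
    unfolding fragments.simps by metis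
  then obtain S' where "S' \<in> A" "S' \<subseteq> P \<union> \<chi> -` set cs" using Cons.IH by blast
  moreover have "P \<union> \<chi> -` set cs \<subseteq> (P - \<chi> -` {c}) \<union> \<chi> -` set (c # cs)" by auto
  ultimately show ?case using P by (metis order_trans)
qed auto

definition heavy_subsets :: "'a set \<Rightarrow> 'a set set" where
  "heavy_subsets B = {Y. Y \<subseteq> B \<and> card B < 2 * card Y}"

lemma finite_heavy_subsets: "finite B \<Longrightarrow> finite (heavy_subsets B)"
  by (simp add: heavy_subsets_def)

lemma sum_heavy_subsets_le:
  fixes \<rho> :: real
  assumes "finite B" "0 \<le> \<rho>" "8 * \<rho> \<le> 1"
  shows "(\<Sum>Y\<in>heavy_subsets B. real (card Y) * \<rho> ^ card Y) \<le> 4 * \<rho>"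
proof -
  have "real (card Y) * \<rho> ^ card Y \<le> 4 * \<rho> / 2 ^ card B" if "Y \<in> heavy_subsets B" for Y
  proof -
    have heavy: "card B < 2 * card Y" using that by (simp add: heavy_subsets_def)
    have "(2::real) * 2 ^ card B \<le> 2 ^ (2 * card Y)"
      using heavy power_increasing[of "Suc (card B)" "2 * card Y" "2::real"] by simp
    then have four_power: "(2::real) * 2 ^ card B \<le> 4 ^ card Y" by (simp add: power_mult)
    have "2 * 2 ^ card B * (2 * \<rho>) ^ card Y \<le> 4 ^ card Y * (2 * \<rho>) ^ card Y"
      using four_power assms(2) by (intro mult_right_mono) auto
    also have "\<dots> = (4 * (2 * \<rho>)) ^ card Y" by (rule power_mult_distrib[symmetric])
    also have "\<dots> \<le> (4 * (2 * \<rho>)) ^ 1"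
      using assms heavy by (intro power_decreasing) auto
    finally have "(2 * \<rho>) ^ card Y \<le> 4 * \<rho> / 2 ^ card B"
      by (simp add: pos_le_divide_eq mult.commute mult.left_commute)
    moreover have "real (card Y) * \<rho> ^ card Y \<le> 2 ^ card Y * \<rho> ^ card Y"
      using assms(2) by (intro mult_right_mono) (auto simp: less_imp_le)
    ultimately show ?thesis by (simp add: power_mult_distrib)
  qed
  then have "(\<Sum>Y\<in>heavy_subsets B. real (card Y) * \<rho> ^ card Y)
      \<le> real (card (heavy_subsets B)) * (4 * \<rho> / 2 ^ card B)"
    by (rule sum_bounded_above)
  also have "\<dots> \<le> 2 ^ card B * (4 * \<rho> / 2 ^ card B)"
  proof (rule mult_right_mono)
    have "card (heavy_subsets B) \<le> card (Pow B)"
      using assms(1) by (intro card_mono) (auto simp: heavy_subsets_def)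
    then show "real (card (heavy_subsets B)) \<le> 2 ^ card B"
      using assms(1) by (simp add: card_Pow)
  qed (use assms(2) in simp)
  finally show ?thesis by simp
qed

section \<open>Rainbow matchings in spread families\<close>

lemma finite_subset_Pow: "A \<subseteq> Pow X \<Longrightarrow> finite X \<Longrightarrow> finite A"
  by (meson finite_Pow_iff finite_subset)

definition containing :: "'a set set \<Rightarrow> 'a set \<Rightarrow> 'a set set" where
  "containing A Y = {S\<in>A. Y \<subseteq> S}"

definition spread :: "real \<Rightarrow> real \<Rightarrow> 'a set set \<Rightarrow> bool" where
  "spread L r A \<longleftrightarrow> (\<forall>Y. real (card (containing A Y)) * r ^ card Y \<le> L * real (card A))"

lemma spreadD: "spread L r A \<Longrightarrow> real (card (containing A Y)) * r ^ card Y \<le> L * real (card A)"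
  by (simp add: spread_def)

lemma containing_subset: "containing A Y \<subseteq> A"
  by (auto simp: containing_def)

lemma finite_containing: "finite A \<Longrightarrow> finite (containing A Y)"
  by (simp add: containing_def)

lemma card_containing_mono: "A \<subseteq> B \<Longrightarrow> finite B \<Longrightarrow> card (containing A Y) \<le> card (containing B Y)"
  by (rule card_mono) (auto simp: containing_def)

lemma containing_empty [simp]: "containing A {} = A"
  by (simp add: containing_def)

lemma spread_ge_1:
  assumes "spread L r A" "finite A" "A \<noteq> {}"
  shows "1 \<le> L"
  using spreadD[OF assms(1), of "{}"] assms(2,3) by (simp add: card_gt_0_iff)

lemma card_override_on_const_fibre_le:
  assumes "finite Y" "finite C" "Y \<subseteq> X"
  shows "card {\<chi> \<in> X \<rightarrow>\<^sub>E C. override_on \<chi> (\<lambda>_. c) Y = \<chi>'} \<le> card C ^ card Y"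
proof -
  let ?fibre = "{\<chi> \<in> X \<rightarrow>\<^sub>E C. override_on \<chi> (\<lambda>_. c) Y = \<chi>'}"
  have "inj_on (\<lambda>\<chi>. restrict \<chi> Y) ?fibre"
  proof (rule inj_onI, rule ext)
    fix \<chi>\<^sub>1 \<chi>\<^sub>2 x
    assume "\<chi>\<^sub>1 \<in> ?fibre" "\<chi>\<^sub>2 \<in> ?fibre" and restrict: "restrict \<chi>\<^sub>1 Y = restrict \<chi>\<^sub>2 Y"
    then have override: "override_on \<chi>\<^sub>1 (\<lambda>_. c) Y x = override_on \<chi>\<^sub>2 (\<lambda>_. c) Y x" by simp
    show "\<chi>\<^sub>1 x = \<chi>\<^sub>2 x"
      using override fun_cong[OF restrict, of x] by (cases "x \<in> Y") auto
  qed
  moreover have "(\<lambda>\<chi>. restrict \<chi> Y) ` ?fibre \<subseteq> Y \<rightarrow>\<^sub>E C" using assms(3) by auto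
  moreover have "finite (Y \<rightarrow>\<^sub>E C)" using assms by (intro finite_PiE) auto
  ultimately have "card ?fibre \<le> card (Y \<rightarrow>\<^sub>E C)" by (rule card_inj_on_le)
  then show ?thesis using assms(1) by (simp add: card_PiE)
qed

locale spread_colouring =
  fixes X :: "'a set" and C :: "'c set" and A :: "'a set set" and L r :: real
  assumes finite_X: "finite X" and finite_C: "finite C"
    and A_subset: "A \<subseteq> Pow X" and A_nonempty: "A \<noteq> {}"
    and spread: "spread L r A" and few_colours: "40 * L * real (card C) \<le> r"
begin

abbreviation colourings :: "('a \<Rightarrow> 'c) set" where
  "colourings \<equiv> X \<rightarrow>\<^sub>E C"

abbreviation target :: "('a \<Rightarrow> 'c) \<Rightarrow> 'c list \<Rightarrow> 'c \<Rightarrow> 'a set" where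
  "target \<chi> cs c \<equiv> smallest_within (fragments A \<chi> cs ` A) (\<chi> -` {c})"

lemma finite_A: "finite A"
  by (rule finite_subset_Pow[OF A_subset finite_X])

lemma finite_colourings: "finite colourings"
  using finite_X finite_C by (intro finite_PiE) auto

lemma fragments_subset_X: "S \<in> A \<Longrightarrow> fragments A \<chi> cs S \<subseteq> X"
  using fragments_subset A_subset by blast

lemma finite_fragments: "S \<in> A \<Longrightarrow> finite (fragments A \<chi> cs S)"
  by (rule finite_subset[OF fragments_subset_X finite_X])

lemma target_subset_X: "target \<chi> cs c \<subseteq> X"
  using smallest_within_subset_Union[of "fragments A \<chi> cs ` A"] fragments_subset_X by fast

lemma finite_target: "finite (target \<chi> cs c)"
  by (rule finite_subset[OF target_subset_X finite_X])

lemma heavy_subset_target: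
  assumes "Y \<in> heavy_subsets (target \<chi> cs c)"
  shows "Y \<subseteq> X" "finite Y"
proof -
  show "Y \<subseteq> X" using assms target_subset_X unfolding heavy_subsets_def by fast
  then show "finite Y" using finite_X by (rule finite_subset)
qed

lemma recoloured_heavy_fragment:
  fixes \<chi> :: "'a \<Rightarrow> 'c" and c :: 'c and cs :: "'c list" and S :: "'a set"
  assumes \<chi>: "\<chi> \<in> colourings" and S: "S \<in> A" and c: "c \<in> C" "c \<notin> set cs"
  defines "Y \<equiv> fragments A \<chi> (c # cs) S"
  defines "\<chi>' \<equiv> override_on \<chi> (\<lambda>_. c) Y"
  assumes heavy: "card (fragments A \<chi> cs S) < 2 * card Y"
  shows "\<chi>' \<in> colourings" "Y \<in> heavy_subsets (target \<chi>' cs c)" "S \<in> containing A Y"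
proof -
  have Y_subset: "Y \<subseteq> fragments A \<chi> cs S" using fragments_Cons_subset[OF S] unfolding Y_def by fast
  then have "Y \<subseteq> X" "Y \<subseteq> S" using fragments_subset_X[OF S] fragments_subset[OF S] by blast+
  then show "\<chi>' \<in> colourings" "S \<in> containing A Y"
    using \<chi> c(1) S unfolding \<chi>'_def
    by (auto simp: override_on_def PiE_iff extensional_def containing_def)
  have "\<chi> x \<notin> set cs" if "x \<in> Y" for x
    using that Y_subset fragments_avoid_colours[OF S] by blast
  then have "\<chi> -` {d} = \<chi>' -` {d}" if "d \<in> set cs" for d
    using that c(2) unfolding \<chi>'_def override_on_def by (auto split: if_splits)
  then have "fragments A \<chi> cs = fragments A \<chi>' cs" by (rule fragments_cong)
  moreover have "\<chi>' -` {c} = \<chi> -` {c} \<union> Y" unfolding \<chi>'_def override_on_def by auto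
  ultimately have "target \<chi>' cs c = smallest_within (fragments A \<chi> cs ` A) (\<chi> -` {c} \<union> Y)" by simp
  moreover have "Y \<subseteq> smallest_within (fragments A \<chi> cs ` A) (\<chi> -` {c} \<union> Y)"
    "card (smallest_within (fragments A \<chi> cs ` A) (\<chi> -` {c} \<union> Y)) \<le> card (fragments A \<chi> cs S)"
    using fragment_subset_smallest_within[of "fragments A \<chi> cs S" "fragments A \<chi> cs ` A" "\<chi> -` {c}"]
      S finite_fragments unfolding Y_def by auto
  ultimately show "Y \<in> heavy_subsets (target \<chi>' cs c)"
    using heavy by (simp add: heavy_subsets_def)
qed

lemma card_le_sum_card_fragments:
  assumes "target \<chi> cs c \<noteq> {}"
  shows "real (card A) \<le> (\<Sum>S\<in>A. real (card (fragments A \<chi> cs S)))"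
proof -
  have "1 \<le> real (card (fragments A \<chi> cs S))" if S: "S \<in> A" for S
  proof (rule ccontr)
    assume "\<not> 1 \<le> real (card (fragments A \<chi> cs S))"
    then have "card (fragments A \<chi> cs S) = 0" by linarith
    then have "fragments A \<chi> cs S = {}" by (simp add: S finite_fragments)
    then have "{} \<in> fragments A \<chi> cs ` A" using S by (metis imageI)
    then have "card (target \<chi> cs c) = 0"
      using smallest_within(3)[of "{}" "fragments A \<chi> cs ` A" "\<chi> -` {c}"] by simp
    then show False using assms finite_target by simp
  qed
  then have "real (card A) * 1 \<le> (\<Sum>S\<in>A. real (card (fragments A \<chi> cs S)))"
    by (rule sum_bounded_below)
  then show ?thesis by simp
qed

definition density :: real where
  "density = real (card C) / r"

lemma density_bounds:
  assumes "c \<in> C"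
  shows "0 \<le> density" "8 * density \<le> 1" "40 * L * density \<le> 1" "0 < r"
proof -
  have L: "1 \<le> L" using spread_ge_1[OF spread finite_A A_nonempty] .
  have C: "0 < real (card C)" using assms finite_C by (auto simp: card_gt_0_iff)
  then have "40 * real (card C) \<le> 40 * L * real (card C)" using L by simp
  then have r: "40 * real (card C) \<le> r" using few_colours by linarith
  then show "0 \<le> density" "8 * density \<le> 1" "40 * L * density \<le> 1" "0 < r"
    using C few_colours by (auto simp: density_def pos_divide_le_eq)
qed

lemma card_containing_mult_colours_le:
  assumes "c \<in> C"
  shows "real (card (containing A Y)) * real (card C) ^ card Y
    \<le> L * real (card A) * density ^ card Y"
proof -
  have "real (card (containing A Y)) * real (card C) ^ card Y
      = real (card (containing A Y)) * r ^ card Y * density ^ card Y"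
    using density_bounds(4)[OF assms] by (simp add: density_def power_divide)
  also have "\<dots> \<le> L * real (card A) * density ^ card Y"
    using spreadD[OF spread] density_bounds(1)[OF assms] by (intro mult_right_mono) auto
  finally show ?thesis .
qed

lemma sum_heavy_subsets_target_le:
  assumes "c \<in> C"
  shows "(\<Sum>Y\<in>heavy_subsets (target \<chi> cs c).
      real (card Y) * (real (card (containing A Y)) * real (card C) ^ card Y))
    \<le> 1 / 10 * (\<Sum>S\<in>A. real (card (fragments A \<chi> cs S)))"
proof (cases "target \<chi> cs c = {}")
  case True
  then show ?thesis by (simp add: heavy_subsets_def sum_nonneg)
next
  case False
  let ?heavy = "heavy_subsets (target \<chi> cs c)"
  have L: "1 \<le> L" using spread_ge_1[OF spread finite_A A_nonempty] .
  have "(\<Sum>Y\<in>?heavy. real (card Y) * (real (card (containing A Y)) * real (card C) ^ card Y))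
      \<le> (\<Sum>Y\<in>?heavy. real (card Y) * (L * real (card A) * density ^ card Y))"
    using card_containing_mult_colours_le[OF assms] by (intro sum_mono mult_left_mono) auto
  also have "\<dots> = L * real (card A) * (\<Sum>Y\<in>?heavy. real (card Y) * density ^ card Y)"
    by (simp add: sum_distrib_left mult_ac)
  also have "\<dots> \<le> L * real (card A) * (4 * density)"
    using L density_bounds(1,2)[OF assms]
    by (intro mult_left_mono sum_heavy_subsets_le finite_target) auto
  also have "\<dots> = (40 * L * density) * (1 / 10 * real (card A))" by simp
  also have "\<dots> \<le> 1 * (1 / 10 * real (card A))"
    using density_bounds(3)[OF assms] by (intro mult_right_mono) auto
  finally show ?thesis using card_le_sum_card_fragments[OF False] by linarith
qed

definition heavy_pairs :: "'c list \<Rightarrow> 'c \<Rightarrow> (('a \<Rightarrow> 'c) \<times> 'a set) set" where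
  "heavy_pairs cs c = {(\<chi>, S). \<chi> \<in> colourings \<and> S \<in> A
    \<and> card (fragments A \<chi> cs S) < 2 * card (fragments A \<chi> (c # cs) S)}"

text \<open>A colouring \<open>\<chi>\<close> and a set \<open>S\<close> with a heavy new fragment \<open>Y\<close> are encoded by \<open>Y\<close>, \<open>S\<close> and the
  recolouring \<open>\<chi>'\<close> of \<open>Y\<close> with \<open>c\<close>. By minimality \<open>Y\<close> lies in a set that depends on \<open>\<chi>'\<close> only, so
  few \<open>Y\<close> are possible, and spreadness bounds the number of \<open>S\<close> containing \<open>Y\<close>.\<close>

definition encode :: "'c list \<Rightarrow> 'c \<Rightarrow> ('a \<Rightarrow> 'c) \<times> 'a set \<Rightarrow> ('a \<Rightarrow> 'c) \<times> 'a set \<times> 'a set" where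
  "encode cs c = (\<lambda>(\<chi>, S). (override_on \<chi> (\<lambda>_. c) (fragments A \<chi> (c # cs) S),
    fragments A \<chi> (c # cs) S, S))"

definition codes :: "'c list \<Rightarrow> 'c \<Rightarrow> (('a \<Rightarrow> 'c) \<times> 'a set \<times> 'a set) set" where
  "codes cs c = (SIGMA \<chi>:colourings. SIGMA Y:heavy_subsets (target \<chi> cs c). containing A Y)"

lemma finite_heavy_pairs: "finite (heavy_pairs cs c)"
  by (rule finite_subset[of _ "colourings \<times> A"])
    (use finite_colourings finite_A in \<open>auto simp: heavy_pairs_def\<close>)

lemma finite_containing_heavy_subset:
  "finite (SIGMA Y:heavy_subsets (target \<chi> cs c). containing A Y)"
  using finite_A by (intro finite_SigmaI finite_heavy_subsets finite_target finite_containing)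

lemma finite_codes: "finite (codes cs c)"
  unfolding codes_def by (intro finite_SigmaI finite_colourings finite_containing_heavy_subset)

lemma encode_in_codes:
  assumes "c \<in> C" "c \<notin> set cs"
  shows "encode cs c ` heavy_pairs cs c \<subseteq> codes cs c"
  using recoloured_heavy_fragment[OF _ _ assms]
  by (auto simp: heavy_pairs_def encode_def codes_def simp del: fragments.simps)

lemma sum_encode_fibre_le:
  assumes "(\<chi>', Y, S') \<in> codes cs c"
  shows "(\<Sum>(\<chi>, S)\<in>{p \<in> heavy_pairs cs c. encode cs c p = (\<chi>', Y, S')}.
      real (card (fragments A \<chi> (c # cs) S))) \<le> real (card Y) * real (card C) ^ card Y"
proof -
  let ?pairs = "{p \<in> heavy_pairs cs c. encode cs c p = (\<chi>', Y, S')}"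
  let ?fibre = "{\<chi> \<in> colourings. override_on \<chi> (\<lambda>_. c) Y = \<chi>'}"
  have "?pairs \<subseteq> (\<lambda>\<chi>. (\<chi>, S')) ` ?fibre"
    by (auto simp: heavy_pairs_def encode_def)
  then have "card ?pairs \<le> card ?fibre"
    using finite_colourings by (intro surj_card_le) auto
  also have "\<dots> \<le> card C ^ card Y"
    using assms heavy_subset_target[of Y \<chi>' cs c] finite_C unfolding codes_def
    by (intro card_override_on_const_fibre_le) blast+
  finally have "real (card ?pairs) \<le> real (card C ^ card Y)" by (rule of_nat_mono)
  moreover have "(\<Sum>(\<chi>, S)\<in>?pairs. real (card (fragments A \<chi> (c # cs) S)))
      = (\<Sum>p\<in>?pairs. real (card Y))"
    by (rule sum.cong) (auto simp: encode_def simp del: fragments.simps)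
  ultimately show ?thesis by (simp add: mult.commute mult_left_mono)
qed

lemma sum_codes_le:
  assumes "c \<in> C"
  shows "(\<Sum>(\<chi>, Y, S)\<in>codes cs c. real (card Y) * real (card C) ^ card Y)
    \<le> 1 / 10 * (\<Sum>\<chi>\<in>colourings. \<Sum>S\<in>A. real (card (fragments A \<chi> cs S)))"
proof -
  have "(\<Sum>(\<chi>, Y, S)\<in>codes cs c. real (card Y) * real (card C) ^ card Y)
      = (\<Sum>\<chi>\<in>colourings. \<Sum>(Y, S)\<in>(SIGMA Y:heavy_subsets (target \<chi> cs c). containing A Y).
          real (card Y) * real (card C) ^ card Y)"
    unfolding codes_def using finite_containing_heavy_subset
    by (subst sum.Sigma[OF finite_colourings]) (auto intro!: sum.cong)
  also have "\<dots> = (\<Sum>\<chi>\<in>colourings. \<Sum>Y\<in>heavy_subsets (target \<chi> cs c).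
      \<Sum>S\<in>containing A Y. real (card Y) * real (card C) ^ card Y)"
    using finite_A
    by (intro sum.cong refl sum.Sigma[symmetric] ballI finite_heavy_subsets finite_target
        finite_containing)
  also have "\<dots> \<le> (\<Sum>\<chi>\<in>colourings. 1 / 10 * (\<Sum>S\<in>A. real (card (fragments A \<chi> cs S))))"
    using sum_heavy_subsets_target_le[OF assms, of _ cs] by (intro sum_mono) (simp add: mult_ac)
  finally show ?thesis by (simp add: sum_distrib_left)
qed

lemma sum_card_heavy_fragments_le:
  assumes "c \<in> C" "c \<notin> set cs"
  shows "(\<Sum>(\<chi>, S)\<in>heavy_pairs cs c. real (card (fragments A \<chi> (c # cs) S)))
    \<le> 1 / 10 * (\<Sum>\<chi>\<in>colourings. \<Sum>S\<in>A. real (card (fragments A \<chi> cs S)))"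
proof -
  have "(\<Sum>(\<chi>, S)\<in>heavy_pairs cs c. real (card (fragments A \<chi> (c # cs) S)))
      = (\<Sum>q\<in>codes cs c. \<Sum>(\<chi>, S)\<in>{p \<in> heavy_pairs cs c. encode cs c p = q}.
          real (card (fragments A \<chi> (c # cs) S)))"
    by (rule sum.group[OF finite_heavy_pairs finite_codes encode_in_codes[OF assms], symmetric])
  also have "\<dots> \<le> (\<Sum>(\<chi>, Y, S)\<in>codes cs c. real (card Y) * real (card C) ^ card Y)"
    by (intro sum_mono) (auto simp del: fragments.simps intro!: sum_encode_fibre_le)
  also note sum_codes_le[OF assms(1)]
  finally show ?thesis .
qed

lemma sum_card_fragments_Cons_le:
  assumes "c \<in> C" "c \<notin> set cs"
  shows "(\<Sum>\<chi>\<in>colourings. \<Sum>S\<in>A. real (card (fragments A \<chi> (c # cs) S)))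
    \<le> 3 / 5 * (\<Sum>\<chi>\<in>colourings. \<Sum>S\<in>A. real (card (fragments A \<chi> cs S)))"
proof -
  let ?old = "\<lambda>\<chi> S. real (card (fragments A \<chi> cs S))"
  let ?new = "\<lambda>\<chi> S. real (card (fragments A \<chi> (c # cs) S))"
  let ?heavy = "heavy_pairs cs c"
  have "(\<Sum>\<chi>\<in>colourings. \<Sum>S\<in>A. ?new \<chi> S)
      \<le> (\<Sum>\<chi>\<in>colourings. \<Sum>S\<in>A. 1 / 2 * ?old \<chi> S + (if (\<chi>, S) \<in> ?heavy then ?new \<chi> S else 0))"
    by (intro sum_mono) (auto simp: heavy_pairs_def)
  also have "\<dots> = 1 / 2 * (\<Sum>\<chi>\<in>colourings. \<Sum>S\<in>A. ?old \<chi> S)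
      + (\<Sum>\<chi>\<in>colourings. \<Sum>S\<in>A. if (\<chi>, S) \<in> ?heavy then ?new \<chi> S else 0)"
    by (simp add: sum.distrib sum_distrib_left)
  also have "(\<Sum>\<chi>\<in>colourings. \<Sum>S\<in>A. if (\<chi>, S) \<in> ?heavy then ?new \<chi> S else 0)
      = (\<Sum>p\<in>colourings \<times> A. if p \<in> ?heavy then case_prod ?new p else 0)"
    by (subst sum.cartesian_product) (auto intro!: sum.cong)
  also have "\<dots> = (\<Sum>p\<in>(colourings \<times> A) \<inter> ?heavy. case_prod ?new p)"
    using finite_colourings finite_A by (intro sum.inter_restrict[symmetric]) auto
  also have "(colourings \<times> A) \<inter> ?heavy = ?heavy" by (auto simp: heavy_pairs_def)
  also have "(\<Sum>(\<chi>, S)\<in>?heavy. ?new \<chi> S) \<le> 1 / 10 * (\<Sum>\<chi>\<in>colourings. \<Sum>S\<in>A. ?old \<chi> S)"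
    by (rule sum_card_heavy_fragments_le[OF assms])
  finally show ?thesis by simp
qed

lemma sum_card_fragments_le:
  assumes "distinct cs" "set cs \<subseteq> C" and card_le: "\<And>S. S \<in> A \<Longrightarrow> card S \<le> k"
  shows "(\<Sum>\<chi>\<in>colourings. \<Sum>S\<in>A. real (card (fragments A \<chi> cs S)))
    \<le> (3 / 5) ^ length cs * (real (card colourings) * (real (card A) * real k))"
  using assms(1,2)
proof (induction cs)
  case Nil
  have "(\<Sum>\<chi>\<in>colourings. \<Sum>S\<in>A. real (card S)) \<le> (\<Sum>\<chi>\<in>colourings. \<Sum>S\<in>A. real k)"
    using card_le by (intro sum_mono) simp
  then show ?case by simp
next
  case (Cons c cs)
  then show ?case using sum_card_fragments_Cons_le[of c cs] by auto
qed

theorem card_colourings_missing_le: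
  assumes "U \<subseteq> C" and "\<And>S. S \<in> A \<Longrightarrow> card S \<le> k"
  shows "real (card {\<chi>\<in>colourings. \<forall>S\<in>A. \<not> \<chi> ` S \<subseteq> U})
    \<le> (3 / 5) ^ card U * real k * real (card colourings)"
proof -
  define missing where "missing = {\<chi>\<in>colourings. \<forall>S\<in>A. \<not> \<chi> ` S \<subseteq> U}"
  obtain cs where cs: "set cs = U" "distinct cs"
    using finite_distinct_list[OF finite_subset[OF assms(1) finite_C]] by auto
  have nonempty: "1 \<le> real (card (fragments A \<chi> cs S))" if \<chi>: "\<chi> \<in> missing" and S: "S \<in> A" for \<chi> S
  proof -
    obtain S' where "S' \<in> A" "S' \<subseteq> fragments A \<chi> cs S \<union> \<chi> -` U"
      using fragments_cover[OF S, of \<chi> cs] cs(1) by auto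
    then have "fragments A \<chi> cs S \<noteq> {}" using \<chi> unfolding missing_def by blast
    then have "card (fragments A \<chi> cs S) \<noteq> 0" by (simp add: S finite_fragments)
    then show ?thesis by linarith
  qed
  have "real (card missing) * real (card A) = (\<Sum>\<chi>\<in>missing. \<Sum>S\<in>A. 1)" by simp
  also have "\<dots> \<le> (\<Sum>\<chi>\<in>missing. \<Sum>S\<in>A. real (card (fragments A \<chi> cs S)))"
    using nonempty by (intro sum_mono)
  also have "\<dots> \<le> (\<Sum>\<chi>\<in>colourings. \<Sum>S\<in>A. real (card (fragments A \<chi> cs S)))"
    using finite_colourings by (intro sum_mono2) (auto simp: missing_def sum_nonneg)
  also have "\<dots> \<le> (3 / 5) ^ length cs * (real (card colourings) * (real (card A) * real k))"
    using sum_card_fragments_le[OF cs(2)] cs(1) assms by simp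
  also have "length cs = card U" using distinct_card[OF cs(2)] cs(1) by simp
  finally have "real (card missing) * real (card A)
      \<le> ((3 / 5) ^ card U * real k * real (card colourings)) * real (card A)"
    by (simp add: mult_ac)
  moreover have "0 < real (card A)" using A_nonempty finite_A by (simp add: card_gt_0_iff)
  ultimately show ?thesis unfolding missing_def by simp
qed

end

locale rainbow_parameters =
  fixes X :: "'a set" and I :: "'i set" and L r :: real and b k :: nat
  assumes finite_X: "finite X" and finite_I: "finite I" and b_pos: "0 < b"
    and few_colours: "40 * L * (real (card I) * real b) \<le> r"
    and small: "real (card I) * ((3 / 5) ^ b * real k) < 1"
begin

lemma exists_rainbow_colouring:
  assumes "I \<noteq> {}" and A: "\<And>i. i \<in> I \<Longrightarrow> A i \<subseteq> Pow X" "\<And>i. i \<in> I \<Longrightarrow> A i \<noteq> {}"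
    and spread: "\<And>i. i \<in> I \<Longrightarrow> spread L r (A i)"
    and card_le: "\<And>i S. i \<in> I \<Longrightarrow> S \<in> A i \<Longrightarrow> card S \<le> k"
  shows "\<exists>\<chi>. \<forall>i\<in>I. \<exists>S\<in>A i. \<chi> ` S \<subseteq> {i} \<times> {..<b}"
proof -
  define C where "C = I \<times> {..<b}"
  define colourings where "colourings = X \<rightarrow>\<^sub>E C"
  define missing where "missing i = {\<chi>\<in>colourings. \<forall>S\<in>A i. \<not> \<chi> ` S \<subseteq> {i} \<times> {..<b}}" for i
  have C: "finite C" "C \<noteq> {}" and card_C: "real (card C) = real (card I) * real b"
    using assms(1) finite_I b_pos by (auto simp: C_def card_cartesian_product)
  have card_colourings: "0 < real (card colourings)"
    using finite_X C by (simp add: colourings_def card_PiE card_gt_0_iff)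
  have "real (card (missing i)) \<le> (3 / 5) ^ b * real k * real (card colourings)" if i: "i \<in> I" for i
  proof -
    interpret spread_colouring X C "A i" L r
      using finite_X C A[OF i] spread[OF i] few_colours card_C by unfold_locales simp_all
    have "{i} \<times> {..<b} \<subseteq> C" using i by (auto simp: C_def)
    then show ?thesis
      using card_colourings_missing_le[of "{i} \<times> {..<b}" k] card_le[OF i]
      by (simp add: missing_def colourings_def card_cartesian_product)
  qed
  then have "(\<Sum>i\<in>I. real (card (missing i)))
      \<le> real (card I) * ((3 / 5) ^ b * real k * real (card colourings))"
    by (rule sum_bounded_above)
  moreover have "real (card (\<Union>i\<in>I. missing i)) \<le> (\<Sum>i\<in>I. real (card (missing i)))"
    using card_UN_le[OF finite_I, of missing] by (metis of_nat_mono of_nat_sum)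
  moreover have "real (card I) * ((3 / 5) ^ b * real k) * real (card colourings)
      < 1 * real (card colourings)"
    using small card_colourings by (intro mult_strict_right_mono) auto
  ultimately have "card (\<Union>i\<in>I. missing i) < card colourings" by (simp add: mult_ac)
  moreover have "(\<Union>i\<in>I. missing i) \<subseteq> colourings" by (auto simp: missing_def)
  ultimately obtain \<chi> where "\<chi> \<in> colourings" "\<chi> \<notin> (\<Union>i\<in>I. missing i)"
    by (metis less_irrefl subsetI subset_antisym)
  then show ?thesis by (auto simp: missing_def)
qed

lemma rainbow_disjoint_sets:
  assumes A: "\<And>i. i \<in> I \<Longrightarrow> A i \<subseteq> Pow X" "\<And>i. i \<in> I \<Longrightarrow> A i \<noteq> {}"
    and spread: "\<And>i. i \<in> I \<Longrightarrow> spread L r (A i)"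
    and card_le: "\<And>i S. i \<in> I \<Longrightarrow> S \<in> A i \<Longrightarrow> card S \<le> k"
  shows "\<exists>R. (\<forall>i\<in>I. R i \<in> A i) \<and> disjoint_family_on R I"
proof (cases "I = {}")
  case False
  obtain \<chi> where "\<forall>i\<in>I. \<exists>S\<in>A i. \<chi> ` S \<subseteq> {i} \<times> {..<b}"
    using exists_rainbow_colouring[OF False A spread card_le] by (rule exE)
  then obtain R where R: "\<And>i. i \<in> I \<Longrightarrow> R i \<in> A i" "\<And>i. i \<in> I \<Longrightarrow> \<chi> ` R i \<subseteq> {i} \<times> {..<b}" by metis
  have "R i \<inter> R j = {}" if "i \<in> I" "j \<in> I" "i \<noteq> j" for i j
    using R(2)[OF that(1)] R(2)[OF that(2)] that(3) by fastforce
  then have "disjoint_family_on R I" by (simp add: disjoint_family_on_def)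
  then show ?thesis using R(1) by blast
qed (simp add: disjoint_family_on_def)

end

definition link :: "'a set set \<Rightarrow> 'a set \<Rightarrow> 'a set set" where
  "link A Y = (\<lambda>S. S - Y) ` containing A Y"

lemma link_mono: "A \<subseteq> B \<Longrightarrow> link A Y \<subseteq> link B Y"
  by (auto simp: link_def containing_def)

lemma inj_on_Diff_containing: "inj_on (\<lambda>S. S - Y) (containing A Y)"
  by (rule inj_onI) (auto simp: containing_def)

lemma card_link: "card (link A Y) = card (containing A Y)"
  unfolding link_def by (rule card_image[OF inj_on_Diff_containing])

lemma card_containing_link:
  "card (containing (link A Y) Z) = (if Y \<inter> Z = {} then card (containing A (Y \<union> Z)) else 0)"
proof (cases "Y \<inter> Z = {}")
  case True
  then have "containing (link A Y) Z = (\<lambda>S. S - Y) ` containing A (Y \<union> Z)"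
    by (auto simp: link_def containing_def)
  moreover have "inj_on (\<lambda>S. S - Y) (containing A (Y \<union> Z))"
    by (rule inj_on_subset[OF inj_on_Diff_containing]) (auto simp: containing_def)
  ultimately show ?thesis using True by (simp add: card_image)
next
  case False
  then have "containing (link A Y) Z = {}" by (auto simp: link_def containing_def)
  then show ?thesis using False by simp
qed

lemma containing_eq: "\<forall>S\<in>A. Y \<subseteq> S \<Longrightarrow> containing A Y = A"
  by (auto simp: containing_def)

lemma spread_subset:
  assumes "spread L r A" "B \<subseteq> A" "finite A" "0 \<le> L" "0 \<le> r" "real (card A) \<le> q * real (card B)"
  shows "spread (L * q) r B"
  unfolding spread_def
proof
  fix Y
  have "card (containing B Y) \<le> card (containing A Y)"
    using assms(2,3) by (rule card_containing_mono)
  then have "real (card (containing B Y)) * r ^ card Y \<le> real (card (containing A Y)) * r ^ card Y"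
    using assms(5) by (intro mult_right_mono) auto
  also have "\<dots> \<le> L * real (card A)" by (rule spreadD[OF assms(1)])
  also have "\<dots> \<le> L * (q * real (card B))" using assms(4,6) by (rule mult_left_mono[rotated])
  finally show "real (card (containing B Y)) * r ^ card Y \<le> L * q * real (card B)" by simp
qed

lemma (in rainbow_parameters) rainbow_disjoint_members:
  assumes B: "\<And>i. i \<in> I \<Longrightarrow> B i \<subseteq> Pow X" "\<And>i. i \<in> I \<Longrightarrow> B i \<noteq> {}"
    and Y_subset: "\<And>i S. i \<in> I \<Longrightarrow> S \<in> B i \<Longrightarrow> Y i \<subseteq> S"
    and Y_avoided: "\<And>i j S. i \<in> I \<Longrightarrow> j \<in> I \<Longrightarrow> i \<noteq> j \<Longrightarrow> S \<in> B i \<Longrightarrow> S \<inter> Y j = {}"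
    and spread: "\<And>i. i \<in> I \<Longrightarrow> spread L r (link (B i) (Y i))"
    and card_le: "\<And>i S. i \<in> I \<Longrightarrow> S \<in> B i \<Longrightarrow> card S \<le> k"
  shows "\<exists>R. (\<forall>i\<in>I. R i \<in> B i) \<and> disjoint_family_on R I"
proof -
  have B_link: "link (B i) (Y i) = (\<lambda>S. S - Y i) ` B i" if "i \<in> I" for i
    using Y_subset[OF that] by (simp add: link_def containing_eq)
  have "\<exists>T. (\<forall>i\<in>I. T i \<in> link (B i) (Y i)) \<and> disjoint_family_on T I"
  proof (rule rainbow_disjoint_sets[OF _ _ spread])
    fix i assume i: "i \<in> I"
    show "link (B i) (Y i) \<subseteq> Pow X" "link (B i) (Y i) \<noteq> {}" using B[OF i] B_link[OF i] by auto
    fix T assume "T \<in> link (B i) (Y i)"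
    then obtain S where S: "S \<in> B i" "T = S - Y i" using B_link[OF i] by auto
    then have "finite S" using B(1)[OF i] finite_X finite_subset by blast
    then show "card T \<le> k" using S card_le[OF i S(1)] card_mono[of S T] by auto
  qed
  then obtain T where T: "\<And>i. i \<in> I \<Longrightarrow> T i \<in> link (B i) (Y i)"
    and disjoint_T: "disjoint_family_on T I"
    by metis
  then have "\<forall>i\<in>I. \<exists>S\<in>B i. T i = S - Y i" using B_link by (metis imageE)
  then obtain R where R: "\<And>i. i \<in> I \<Longrightarrow> R i \<in> B i" "\<And>i. i \<in> I \<Longrightarrow> T i = R i - Y i" by metis
  have "R i \<inter> R j = {}" if "i \<in> I" "j \<in> I" "i \<noteq> j" for i j
    using disjoint_family_onD[OF disjoint_T that] Y_avoided[OF that R(1)[OF that(1)]]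
      Y_avoided[OF that(2,1) that(3)[symmetric] R(1)[OF that(2)]] R(2)[OF that(1)] R(2)[OF that(2)]
    by blast
  then have "disjoint_family_on R I" by (simp add: disjoint_family_on_def)
  then show ?thesis using R(1) by blast
qed

section \<open>Cores\<close>

definition spread_core :: "real \<Rightarrow> 'a set set \<Rightarrow> 'a set \<Rightarrow> bool" where
  "spread_core r F Y \<longleftrightarrow> (\<exists>B\<subseteq>F. B \<noteq> {} \<and> (\<forall>S\<in>B. Y \<subseteq> S) \<and> spread 1 r (link B Y))"

lemma spread_core_mono: "spread_core r F Y \<Longrightarrow> F \<subseteq> F' \<Longrightarrow> spread_core r F' Y"
  unfolding spread_core_def by (meson subset_trans)

lemma card_hitting_le:
  assumes "finite V" "finite A"
  shows "card {S\<in>A. S \<inter> V \<noteq> {}} \<le> (\<Sum>v\<in>V. card (containing A {v}))"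
proof -
  have "card {S\<in>A. S \<inter> V \<noteq> {}} \<le> card (\<Union>v\<in>V. containing A {v})"
    using assms by (intro card_mono finite_UN_I finite_containing) (auto simp: containing_def)
  also have "\<dots> \<le> (\<Sum>v\<in>V. card (containing A {v}))" using assms(1) by (rule card_UN_le)
  finally show ?thesis .
qed

lemma spread_card_hitting_le:
  assumes "spread L r A" "finite A" "finite V" "0 < r"
  shows "real (card {S\<in>A. S \<inter> V \<noteq> {}}) \<le> real (card V) * (L * real (card A) / r)"
proof -
  have "real (card (containing A {v})) \<le> L * real (card A) / r" for v
    using spreadD[OF assms(1), of "{v}"] assms(4) by (simp add: pos_le_divide_eq)
  then have "(\<Sum>v\<in>V. real (card (containing A {v}))) \<le> real (card V) * (L * real (card A) / r)"
    by (intro sum_bounded_above)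
  moreover have "real (card {S\<in>A. S \<inter> V \<noteq> {}}) \<le> (\<Sum>v\<in>V. real (card (containing A {v})))"
    using of_nat_mono[OF card_hitting_le[OF assms(3,2)], where 'a = real] by simp
  ultimately show ?thesis by linarith
qed

lemma spread_link_avoiding:
  assumes "\<forall>S\<in>B. Y \<subseteq> S" "finite B" "B \<noteq> {}" "spread 1 r (link B Y)"
    and V: "finite V" "V \<inter> Y = {}" "2 * real (card V) \<le> r" and "0 < r"
  defines "B' \<equiv> {S\<in>B. S \<inter> V = {}}"
  shows "B' \<noteq> {}" "spread 2 r (link B' Y)"
proof -
  have finite_link: "finite (link B Y)" and card_link_B: "card (link B Y) = card B"
    using assms(1,2) card_link[of B Y] by (auto simp: link_def containing_eq)
  have "(S - Y) \<inter> V = S \<inter> V" for S using V(2) by blast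
  moreover have "containing B Y = B" "containing B' Y = B'"
    using assms(1) by (auto simp: B'_def containing_eq)
  ultimately have link_B': "link B' Y = link B Y - {T\<in>link B Y. T \<inter> V \<noteq> {}}"
    unfolding link_def B'_def by auto
  have "real (card {T\<in>link B Y. T \<inter> V \<noteq> {}}) \<le> real (card V) * (1 * real (card (link B Y)) / r)"
    using assms(4) finite_link V(1) \<open>0 < r\<close> by (rule spread_card_hitting_le)
  also have "\<dots> \<le> r / 2 * (1 * real (card (link B Y)) / r)"
    using V(3) \<open>0 < r\<close> by (intro mult_right_mono) auto
  also have "\<dots> = real (card (link B Y)) / 2" using \<open>0 < r\<close> by simp
  finally have "real (card {T\<in>link B Y. T \<inter> V \<noteq> {}}) \<le> real (card (link B Y)) / 2" .
  moreover have "card (link B' Y) = card (link B Y) - card {T\<in>link B Y. T \<inter> V \<noteq> {}}"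
    unfolding link_B' using finite_link by (intro card_Diff_subset) auto
  moreover have "card {T\<in>link B Y. T \<inter> V \<noteq> {}} \<le> card (link B Y)"
    using finite_link by (intro card_mono) auto
  ultimately have half: "real (card (link B Y)) \<le> 2 * real (card (link B' Y))" by linarith
  then show "spread 2 r (link B' Y)"
    using spread_subset[OF assms(4) link_mono finite_link, of B' 2] \<open>0 < r\<close> by (auto simp: B'_def)
  have "0 < card B" using assms(2,3) by (simp add: card_gt_0_iff)
  then have "0 < card (link B' Y)" using half card_link_B by linarith
  then show "B' \<noteq> {}" by (auto simp: link_def containing_def)
qed

lemma spread_core_finite:
  assumes "spread_core r F Y" "\<And>S. S \<in> F \<Longrightarrow> finite S"
  shows "finite Y"
proof -
  obtain S where "S \<in> F" "Y \<subseteq> S" using assms(1) unfolding spread_core_def by blast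
  then show ?thesis using assms(2) finite_subset by blast
qed

lemma spread_core_avoiding:
  assumes "spread_core r F Y" "finite F" "finite V" "V \<inter> Y = {}" "2 * real (card V) \<le> r" "0 < r"
  shows "\<exists>B\<subseteq>F. B \<noteq> {} \<and> (\<forall>S\<in>B. Y \<subseteq> S \<and> S \<inter> V = {}) \<and> spread 2 r (link B Y)"
proof -
  obtain B where B: "B \<subseteq> F" "B \<noteq> {}" "\<forall>S\<in>B. Y \<subseteq> S" "spread 1 r (link B Y)"
    using assms(1) unfolding spread_core_def by blast
  have "finite B" using B(1) assms(2) by (rule finite_subset)
  note avoiding = spread_link_avoiding[OF B(3) this B(2,4) assms(3-6)]
  show ?thesis
    by (rule exI[of _ "{S\<in>B. S \<inter> V = {}}"]) (use avoiding B in auto)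
qed

lemma card_Union_le_mult:
  assumes "finite \<Y>" "\<Z> \<subseteq> \<Y>" "\<And>Y. Y \<in> \<Y> \<Longrightarrow> card Y \<le> b"
  shows "card (\<Union>\<Z>) \<le> card \<Y> * b"
proof -
  have "card (\<Union>\<Z>) \<le> sum card \<Z>" by (rule card_Union_le_sum_card)
  also have "\<dots> \<le> sum card \<Y>" using assms(1,2) by (intro sum_mono2) auto
  also have "\<dots> \<le> card \<Y> * b" using sum_bounded_above[of \<Y> card b] assms(3) by simp
  finally show ?thesis .
qed

lemma spread_core_avoiding_others:
  assumes "finite F" "\<And>S. S \<in> F \<Longrightarrow> finite S" and \<Y>: "finite \<Y>" "disjoint \<Y>"
    and core: "\<And>Y. Y \<in> \<Y> \<Longrightarrow> spread_core r F Y" and small_core: "\<And>Y. Y \<in> \<Y> \<Longrightarrow> card Y \<le> b"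
    and r: "2 * (real (card \<Y>) * real b) \<le> r" and "0 < b" and Y: "Y \<in> \<Y>"
  shows "\<exists>B\<subseteq>F. B \<noteq> {} \<and> (\<forall>S\<in>B. Y \<subseteq> S \<and> S \<inter> \<Union>(\<Y> - {Y}) = {}) \<and> spread 2 r (link B Y)"
proof (rule spread_core_avoiding[OF core[OF Y] assms(1)])
  show "finite (\<Union>(\<Y> - {Y}))" using \<Y>(1) spread_core_finite[OF core assms(2)] by blast
  show "\<Union>(\<Y> - {Y}) \<inter> Y = {}" using disjointD[OF \<Y>(2) _ Y] by blast
  have "card (\<Union>(\<Y> - {Y})) \<le> card \<Y> * b"
    using \<Y>(1) small_core by (intro card_Union_le_mult) auto
  then have "real (card (\<Union>(\<Y> - {Y}))) \<le> real (card \<Y>) * real b" by (metis of_nat_le_iff of_nat_mult)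
  then show "2 * real (card (\<Union>(\<Y> - {Y}))) \<le> r" using r by linarith
  have "0 < card \<Y>" using Y \<Y>(1) by (auto simp: card_gt_0_iff)
  then have "0 < real (card \<Y>) * real b" using \<open>0 < b\<close> by simp
  then show "0 < r" using r by linarith
qed

lemma spread_cores_matching:
  fixes \<Y> :: "'a set set"
  assumes "finite X" and F: "F \<subseteq> Pow X" "{} \<notin> F" and \<Y>: "finite \<Y>" "disjoint \<Y>"
    and core: "\<And>Y. Y \<in> \<Y> \<Longrightarrow> spread_core r F Y" and small_core: "\<And>Y. Y \<in> \<Y> \<Longrightarrow> card Y \<le> b"
    and r: "80 * (real (card \<Y>) * real b) \<le> r"
    and card_le: "\<And>S. S \<in> F \<Longrightarrow> card S \<le> k"
    and small: "real (card \<Y>) * ((3 / 5) ^ b * real k) < 1" and "0 < b"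
  obtains M where "M \<subseteq> F" "disjoint M" "card M = card \<Y>"
proof -
  have finite_F: "finite F" using F(1) assms(1) by (rule finite_subset_Pow)
  have finite_member: "finite S" if "S \<in> F" for S using that F(1) assms(1) finite_subset by blast
  have "0 \<le> real (card \<Y>) * real b" by simp
  then have "2 * (real (card \<Y>) * real b) \<le> r" using r by linarith
  note spread_core_avoiding_others[OF finite_F finite_member \<Y> core small_core this \<open>0 < b\<close>]
  then obtain B where B: "\<And>Y. Y \<in> \<Y> \<Longrightarrow> B Y \<subseteq> F" "\<And>Y. Y \<in> \<Y> \<Longrightarrow> B Y \<noteq> {}"
    "\<And>Y. Y \<in> \<Y> \<Longrightarrow> \<forall>S\<in>B Y. Y \<subseteq> S \<and> S \<inter> \<Union>(\<Y> - {Y}) = {}" "\<And>Y. Y \<in> \<Y> \<Longrightarrow> spread 2 r (link (B Y) Y)"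
    by metis
  interpret rainbow_parameters X \<Y> 2 r b k
    using assms(1) \<Y>(1) \<open>0 < b\<close> r small by unfold_locales auto
  have "\<exists>R. (\<forall>Y\<in>\<Y>. R Y \<in> B Y) \<and> disjoint_family_on R \<Y>"
  proof (rule rainbow_disjoint_members[OF _ B(2) _ _ B(4)])
    show "B Y \<subseteq> Pow X" if "Y \<in> \<Y>" for Y using B(1)[OF that] F(1) by auto
    show "Y \<subseteq> S" if "Y \<in> \<Y>" "S \<in> B Y" for Y S using B(3)[OF that(1)] that(2) by auto
    show "S \<inter> Z = {}" if "Y \<in> \<Y>" "Z \<in> \<Y>" "Y \<noteq> Z" "S \<in> B Y" for Y Z S
      using B(3)[OF that(1)] that by auto
    show "card S \<le> k" if "Y \<in> \<Y>" "S \<in> B Y" for Y S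
      using B(1)[OF that(1)] that(2) by (intro card_le) auto
  qed
  then obtain R where "\<And>Y. Y \<in> \<Y> \<Longrightarrow> R Y \<in> B Y" and disjoint_R: "disjoint_family_on R \<Y>" by metis
  then have R_F: "R Y \<in> F" if "Y \<in> \<Y>" for Y using that B(1) by blast
  then have "R Y \<noteq> {}" if "Y \<in> \<Y>" for Y using that F(2) by metis
  then have "disjoint (R ` \<Y>) \<and> inj_on R \<Y>"
    using disjoint_R disjoint_family_on_iff_disjoint_image by blast
  then show ?thesis using that[of "R ` \<Y>"] R_F by (auto simp: card_image)
qed

definition core_assignment :: "real \<Rightarrow> (nat \<Rightarrow> real) \<Rightarrow> 'a set set \<Rightarrow> ('a set \<Rightarrow> 'a set) \<Rightarrow> bool" where
  "core_assignment r \<Delta> F \<kappa> \<longleftrightarrow>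
    (\<forall>S\<in>F. \<kappa> S \<noteq> {} \<and> \<kappa> S \<subseteq> S \<and> spread_core r F (\<kappa> S)) \<and>
    (\<forall>j v. real (card {S\<in>containing F {v}. j \<le> card (\<kappa> S)}) \<le> \<Delta> j)"

lemma core_assignmentD:
  assumes "core_assignment r \<Delta> F \<kappa>"
  shows "S \<in> F \<Longrightarrow> \<kappa> S \<noteq> {}" "S \<in> F \<Longrightarrow> \<kappa> S \<subseteq> S" "S \<in> F \<Longrightarrow> spread_core r F (\<kappa> S)"
    "real (card {S\<in>containing F {v}. j \<le> card (\<kappa> S)}) \<le> \<Delta> j"
  using assms by (auto simp: core_assignment_def)

definition heaviest :: "'a set \<Rightarrow> real \<Rightarrow> 'a set set \<Rightarrow> 'a set \<Rightarrow> bool" where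
  "heaviest X r F Y \<longleftrightarrow> Y \<noteq> {} \<and> Y \<subseteq> X \<and> containing F Y \<noteq> {} \<and>
    (\<forall>Z. Z \<noteq> {} \<longrightarrow> Z \<subseteq> X \<longrightarrow>
      real (card (containing F Z)) * r ^ card Z \<le> real (card (containing F Y)) * r ^ card Y)"

lemma heaviestD:
  assumes "heaviest X r F Y"
  shows "Y \<noteq> {}" "Y \<subseteq> X" "containing F Y \<noteq> {}"
    "Z \<noteq> {} \<Longrightarrow> Z \<subseteq> X \<Longrightarrow>
      real (card (containing F Z)) * r ^ card Z \<le> real (card (containing F Y)) * r ^ card Y"
  using assms by (simp_all add: heaviest_def)

lemma heaviest_exists:
  assumes "finite X" "F \<subseteq> Pow X" "{} \<notin> F" "F \<noteq> {}" "0 < r"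
  shows "\<exists>Y. heaviest X r F Y"
proof -
  define weight where "weight Y = real (card (containing F Y)) * r ^ card Y" for Y
  define candidates where "candidates = Pow X - {{}}"
  obtain S where S: "S \<in> F" using assms(4) by blast
  then have S_candidate: "S \<in> candidates" using assms(2,3) by (auto simp: candidates_def)
  have finite_weights: "finite (weight ` candidates)" using assms(1) by (simp add: candidates_def)
  then have "Max (weight ` candidates) \<in> weight ` candidates"
    using S_candidate by (intro Max_in) auto
  then obtain Y where Y: "Y \<in> candidates" "weight Y = Max (weight ` candidates)" by auto
  then have maximal: "weight Z \<le> weight Y" if "Z \<in> candidates" for Z
    using that finite_weights by simp
  have "finite F" using assms(2,1) by (rule finite_subset_Pow)
  then have "0 < card (containing F S)"
    using S by (auto simp: card_gt_0_iff finite_containing containing_def)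
  then have "0 < weight S" using \<open>0 < r\<close> by (simp add: weight_def)
  then have "0 < weight Y" using maximal[OF S_candidate] by linarith
  then have "containing F Y \<noteq> {}" by (auto simp: weight_def)
  then have "heaviest X r F Y"
    using Y maximal by (auto simp: heaviest_def candidates_def weight_def)
  then show ?thesis by (rule exI)
qed

lemma heaviest_imp_spread_core:
  assumes "finite X" "F \<subseteq> Pow X" "0 < r" and Y: "heaviest X r F Y"
  shows "spread_core r F Y"
  unfolding spread_core_def
proof (intro exI[of _ "containing F Y"] conjI)
  have nested: "containing (containing F Y) (Y \<union> Z) = containing F (Y \<union> Z)" for Z
    by (auto simp: containing_def)
  show "spread 1 r (link (containing F Y) Y)"
    unfolding spread_def card_link card_containing_link nested
  proof
    fix Z
    consider (meets) "Y \<inter> Z \<noteq> {}" | (outside) "\<not> Z \<subseteq> X" | (inside) "Y \<inter> Z = {}" "Z \<subseteq> X" by blast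
    then show "real (if Y \<inter> Z = {} then card (containing F (Y \<union> Z)) else 0) * r ^ card Z
        \<le> 1 * real (card (containing (containing F Y) Y))"
    proof cases
      case outside
      then have "containing F (Y \<union> Z) = {}" using assms(2) by (auto simp: containing_def)
      then show ?thesis by simp
    next
      case inside
      have "card (Y \<union> Z) = card Z + card Y"
        using inside assms(1) heaviestD(2)[OF Y] finite_subset by (subst card_Un_disjoint) auto
      then have "real (card (containing F (Y \<union> Z))) * r ^ card Z * r ^ card Y
          \<le> real (card (containing F Y)) * r ^ card Y"
        using heaviestD(4)[OF Y, of "Y \<union> Z"] heaviestD(1,2)[OF Y] inside(2)
        by (simp add: power_add mult.assoc)
      then show ?thesis using inside \<open>0 < r\<close> nested[of "{}"] by simp
    qed simp
  qed
qed (use heaviestD(3)[OF Y] containing_subset in \<open>auto simp: containing_def\<close>)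

lemma card_containing_singleton_le_if_heaviest:
  assumes "finite X" "F \<subseteq> Pow X" "0 < r" and Y: "heaviest X r F Y"
  shows "real (card (containing F {v})) \<le> real (card (containing F Y)) * r ^ (card Y - 1)"
proof (cases "v \<in> X")
  case True
  have "finite Y" using heaviestD(2)[OF Y] assms(1) by (rule finite_subset)
  then have "0 < card Y" using heaviestD(1)[OF Y] by (simp add: card_gt_0_iff)
  then have "r ^ card Y = r ^ (card Y - 1) * r" by (cases "card Y") auto
  then have "real (card (containing F {v})) * r
      \<le> real (card (containing F Y)) * r ^ (card Y - 1) * r"
    using heaviestD(4)[OF Y, of "{v}"] True by simp
  then show ?thesis using \<open>0 < r\<close> by simp
next
  case False
  then have "containing F {v} = {}" using assms(2) by (auto simp: containing_def)
  then show ?thesis using \<open>0 < r\<close> by simp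
qed

lemma core_assignment_extend:
  assumes "finite F" "antimono \<Delta>" "Y \<noteq> {}" "spread_core r F Y"
    and degree_le: "\<And>v. real (card (containing F {v})) \<le> \<Delta> (card Y)"
  defines "G \<equiv> F - containing F Y"
  assumes \<kappa>: "core_assignment r \<Delta> G \<kappa>"
  shows "core_assignment r \<Delta> F (\<lambda>S. if S \<in> containing F Y then Y else \<kappa> S)"
proof -
  define \<kappa>' where "\<kappa>' S = (if S \<in> containing F Y then Y else \<kappa> S)" for S
  have "real (card {S\<in>containing F {v}. j \<le> card (\<kappa>' S)}) \<le> \<Delta> j" for j v
  proof (cases "j \<le> card Y")
    case True
    have "card {S\<in>containing F {v}. j \<le> card (\<kappa>' S)} \<le> card (containing F {v})"
      using assms(1) by (intro card_mono finite_containing) auto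
    moreover have "\<Delta> (card Y) \<le> \<Delta> j" using assms(2) True by (rule antimonoD)
    ultimately show ?thesis using degree_le[of v] by linarith
  next
    case False
    then have "{S\<in>containing F {v}. j \<le> card (\<kappa>' S)} = {S\<in>containing G {v}. j \<le> card (\<kappa> S)}"
      by (auto simp: \<kappa>'_def G_def containing_def)
    then show ?thesis using core_assignmentD(4)[OF \<kappa>] by simp
  qed
  moreover have "\<kappa>' S \<noteq> {} \<and> \<kappa>' S \<subseteq> S \<and> spread_core r F (\<kappa>' S)" if "S \<in> F" for S
    using that assms(3,4) core_assignmentD(1-3)[OF \<kappa>, of S] spread_core_mono[of r G "\<kappa> S" F]
    by (auto simp: \<kappa>'_def G_def containing_def)
  ultimately show ?thesis unfolding \<kappa>'_def by (simp add: core_assignment_def)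
qed

text \<open>Greedy choice: remove the members that contain a heaviest \<open>Y\<close>, and repeat. Comparing \<open>Y\<close> with
  singletons bounds all degrees at that moment in terms of \<open>card Y\<close>.\<close>

lemma core_assignment_exists:
  assumes "finite X" and F: "F \<subseteq> Pow X" "{} \<notin> F" and "0 < r"
    and \<Delta>: "antimono \<Delta>" "\<And>j. 0 \<le> \<Delta> j"
    and degree: "\<And>Y. Y \<subseteq> X \<Longrightarrow> Y \<noteq> {} \<Longrightarrow> real (card (containing F Y)) * r ^ (card Y - 1) \<le> \<Delta> (card Y)"
  shows "\<exists>\<kappa>. core_assignment r \<Delta> F \<kappa>"
  using F degree
proof (induction "card F" arbitrary: F rule: less_induct)
  case less
  note F = less.prems(1,2) and degree = less.prems(3)
  have finite_F: "finite F" using F(1) assms(1) by (rule finite_subset_Pow)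
  show ?case
  proof (cases "F = {}")
    case True
    then show ?thesis using \<Delta>(2) by (auto simp: core_assignment_def containing_def)
  next
    case False
    then obtain Y where Y: "heaviest X r F Y" using heaviest_exists assms(1) F \<open>0 < r\<close> by blast
    define G where "G = F - containing F Y"
    have G_subset: "G \<subseteq> F" unfolding G_def by auto
    have "\<exists>\<kappa>. core_assignment r \<Delta> G \<kappa>"
    proof (rule less.hyps)
      show "card G < card F"
        unfolding G_def using heaviestD(3)[OF Y] finite_F containing_subset
        by (intro psubset_card_mono) auto
      show "real (card (containing G Z)) * r ^ (card Z - 1) \<le> \<Delta> (card Z)" if "Z \<subseteq> X" "Z \<noteq> {}" for Z
      proof -
        have "real (card (containing G Z)) * r ^ (card Z - 1)
            \<le> real (card (containing F Z)) * r ^ (card Z - 1)"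
          using card_containing_mono[OF G_subset finite_F] \<open>0 < r\<close> by (intro mult_right_mono) auto
        then show ?thesis using degree[OF that] by linarith
      qed
    qed (use G_subset F in auto)
    then obtain \<kappa> where \<kappa>: "core_assignment r \<Delta> G \<kappa>" by (rule exE)
    have "spread_core r F Y"
      using assms(1) F(1) \<open>0 < r\<close> Y by (rule heaviest_imp_spread_core)
    moreover have "real (card (containing F {v})) \<le> \<Delta> (card Y)" for v
      using card_containing_singleton_le_if_heaviest[OF assms(1) F(1) \<open>0 < r\<close> Y]
        degree[OF heaviestD(2,1)[OF Y]]
      by (rule order_trans)
    ultimately have "core_assignment r \<Delta> F (\<lambda>S. if S \<in> containing F Y then Y else \<kappa> S)"
      by (rule core_assignment_extend[OF finite_F \<Delta>(1) heaviestD(1)[OF Y] _ _ \<kappa>[unfolded G_def]])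
    then show ?thesis by (intro exI)
  qed
qed

lemma obtain_maximal_disjoint_subfamily:
  assumes "finite \<Y>"
  obtains M where "M \<subseteq> \<Y>" "disjoint M" "\<And>Y. Y \<in> \<Y> \<Longrightarrow> Y \<noteq> {} \<Longrightarrow> Y \<inter> \<Union>M \<noteq> {}"
proof -
  let ?P = "\<lambda>M. M \<subseteq> \<Y> \<and> disjoint M"
  have "\<exists>M. ?P M \<and> (\<forall>M'. ?P M' \<longrightarrow> card M' \<le> card M)"
  proof (rule ex_has_greatest_nat[of ?P "{}"])
    show "\<forall>M. ?P M \<longrightarrow> card M < Suc (card \<Y>)"
      using assms by (auto simp: less_Suc_eq_le intro: card_mono)
  qed simp
  then obtain M where M: "?P M" and largest: "\<And>M'. ?P M' \<Longrightarrow> card M' \<le> card M" by blast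
  have "Y \<inter> \<Union>M \<noteq> {}" if Y: "Y \<in> \<Y>" "Y \<noteq> {}" for Y
  proof
    assume avoid: "Y \<inter> \<Union>M = {}"
    then have "Y \<notin> M" using Y(2) by auto
    moreover have "finite M" using M assms finite_subset by blast
    moreover have "?P (insert Y M)"
      using M Y(1) avoid by (auto simp: pairwise_insert disjnt_def)
    ultimately show False using largest[of "insert Y M"] by simp
  qed
  then show ?thesis using that M by blast
qed

locale matching_free_family =
  fixes X :: "'a set" and F :: "'a set set" and s b k :: nat and r :: real
  assumes finite_X: "finite X" and F_subset: "F \<subseteq> Pow X" and empty_notin: "{} \<notin> F"
    and s_pos: "0 < s" and b_pos: "0 < b"
    and matching_less: "\<And>M. M \<subseteq> F \<Longrightarrow> disjoint M \<Longrightarrow> card M < s"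
    and card_le: "\<And>S. S \<in> F \<Longrightarrow> card S \<le> k" and small: "real s * ((3 / 5) ^ b * real k) < 1"
    and r_ge: "80 * (real s * real b) \<le> r"
begin

lemma finite_F: "finite F"
  by (rule finite_subset_Pow[OF F_subset finite_X])

lemma finite_member: "S \<in> F \<Longrightarrow> finite S"
  using F_subset finite_X finite_subset by blast

lemma card_disjoint_cores_less:
  assumes "finite \<Y>" "disjoint \<Y>" "\<And>Y. Y \<in> \<Y> \<Longrightarrow> spread_core r F Y" "\<And>Y. Y \<in> \<Y> \<Longrightarrow> card Y \<le> b"
  shows "card \<Y> < s"
proof (rule ccontr)
  assume "\<not> card \<Y> < s"
  then obtain \<Z> where \<Z>: "\<Z> \<subseteq> \<Y>" "card \<Z> = s" "finite \<Z>" by (metis not_le obtain_subset_with_card_n)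
  obtain M where "M \<subseteq> F" "disjoint M" "card M = card \<Z>"
  proof (rule spread_cores_matching[OF finite_X F_subset empty_notin \<Z>(3)])
    show "disjoint \<Z>" using assms(2) \<Z>(1) by (rule pairwise_subset)
  qed (use assms \<Z> r_ge card_le small b_pos in auto)
  then show False using matching_less[of M] \<Z>(2) by simp
qed

definition singleton_cores :: "('a set \<Rightarrow> 'a set) \<Rightarrow> 'a set" where
  "singleton_cores \<kappa> = {v. {v} \<in> \<kappa> ` F}"

context
  fixes \<Delta> :: "nat \<Rightarrow> real" and \<kappa> :: "'a set \<Rightarrow> 'a set"
  assumes \<kappa>: "core_assignment r \<Delta> F \<kappa>" and \<Delta>_nonneg: "\<And>j. 0 \<le> \<Delta> j"
begin

abbreviation H :: "'a set" where
  "H \<equiv> singleton_cores \<kappa>"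

lemma singleton_cores_subset: "H \<subseteq> X"
  using core_assignmentD(2)[OF \<kappa>] F_subset unfolding singleton_cores_def by blast

lemma finite_core: "S \<in> F \<Longrightarrow> finite (\<kappa> S)"
  using core_assignmentD(2)[OF \<kappa>] finite_member finite_subset by blast

lemma card_singleton_cores_Un_less:
  assumes M: "M \<subseteq> \<kappa> ` F" "disjoint M" "\<And>Y. Y \<in> M \<Longrightarrow> Y \<inter> H = {} \<and> card Y \<le> b" and "{} \<notin> M"
  shows "card H + card M < s"
proof -
  define singletons where "singletons = (\<lambda>v. {v}) ` H"
  have finite_M: "finite M" using M(1) finite_F by (meson finite_imageI finite_subset)
  have finite_H: "finite H" using singleton_cores_subset finite_X by (rule finite_subset)
  have "card singletons = card H"
    unfolding singletons_def by (intro card_image) (auto simp: inj_on_def)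
  moreover have "singletons \<inter> M = {}" using M(3) by (fastforce simp: singletons_def)
  ultimately have "card (singletons \<union> M) = card H + card M"
    using finite_M finite_H by (subst card_Un_disjoint) (auto simp: singletons_def)
  moreover have "card (singletons \<union> M) < s"
  proof (rule card_disjoint_cores_less)
    have "\<Union>singletons \<inter> \<Union>M = {}" using M(3) by (fastforce simp: singletons_def)
    moreover have "disjoint singletons" by (auto simp: singletons_def pairwise_def disjnt_def)
    ultimately show "disjoint (singletons \<union> M)" using M(2) by (intro disjoint_union)
    show "spread_core r F Y" if "Y \<in> singletons \<union> M" for Y
      using that M(1) core_assignmentD(3)[OF \<kappa>]
      by (auto simp: singletons_def singleton_cores_def; metis)
    show "card Y \<le> b" if "Y \<in> singletons \<union> M" for Y
      using that M(3) b_pos by (auto simp: singletons_def)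
  qed (use finite_M finite_H in \<open>simp add: singletons_def\<close>)
  ultimately show ?thesis by simp
qed

lemma card_singleton_cores_less: "card H < s"
  using card_singleton_cores_Un_less[of "{}"] by simp

text \<open>The transversal is the union of a maximal disjoint family of cores of size \<open>j\<close> that avoid
  \<open>H\<close>.\<close>

lemma obtain_core_transversal:
  assumes "j \<le> b"
  obtains V where "finite V" "card V \<le> (s - 1 - card H) * j"
    "\<And>S. S \<in> F \<Longrightarrow> S \<inter> H = {} \<Longrightarrow> card (\<kappa> S) = j \<Longrightarrow> S \<inter> V \<noteq> {}"
proof -
  define level where "level = {S\<in>F. S \<inter> H = {} \<and> card (\<kappa> S) = j}"
  have "finite (\<kappa> ` level)" using finite_F by (simp add: level_def)
  then obtain M where M: "M \<subseteq> \<kappa> ` level" "disjoint M"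
    and maximal: "\<And>Y. Y \<in> \<kappa> ` level \<Longrightarrow> Y \<noteq> {} \<Longrightarrow> Y \<inter> \<Union>M \<noteq> {}"
    using obtain_maximal_disjoint_subfamily[of "\<kappa> ` level"] by blast
  have core: "\<kappa> S \<noteq> {}" "\<kappa> S \<subseteq> S" if "S \<in> level" for S
    using that core_assignmentD(1,2)[OF \<kappa>] by (auto simp: level_def)
  have finite_M: "finite M" using M(1) \<open>finite (\<kappa> ` level)\<close> by (rule finite_subset)
  have "card H + card M < s"
  proof (rule card_singleton_cores_Un_less[OF _ M(2)])
    show "M \<subseteq> \<kappa> ` F" using M(1) by (auto simp: level_def)
    show "{} \<notin> M" using M(1) core(1) by (metis imageE subsetD)
    show "Y \<inter> H = {} \<and> card Y \<le> b" if "Y \<in> M" for Y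
      using that M(1) core(2) assms by (fastforce simp: level_def)
  qed
  then have "card M * j \<le> (s - 1 - card H) * j" by (intro mult_le_mono1) linarith
  moreover have "card (\<Union>M) \<le> card M * j"
    using finite_M M(1) by (intro card_Union_le_mult) (auto simp: level_def)
  ultimately have "card (\<Union>M) \<le> (s - 1 - card H) * j" by linarith
  moreover have "finite Y" if "Y \<in> M" for Y using that M(1) finite_core by (auto simp: level_def)
  moreover have "S \<inter> \<Union>M \<noteq> {}" if "S \<in> level" for S
    using maximal[OF imageI[OF that] core(1)[OF that]] core(2)[OF that] by blast
  ultimately show ?thesis using that[of "\<Union>M"] finite_M by (auto simp: level_def)
qed

lemma card_avoiding_core_size_le:
  assumes "j \<le> b"
  shows "real (card {S\<in>F. S \<inter> H = {} \<and> card (\<kappa> S) = j}) \<le> real (s - 1 - card H) * (real j * \<Delta> j)"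
proof -
  define level where "level = {S\<in>F. S \<inter> H = {} \<and> card (\<kappa> S) = j}"
  obtain V where V: "finite V" "card V \<le> (s - 1 - card H) * j"
    and hit: "\<And>S. S \<in> F \<Longrightarrow> S \<inter> H = {} \<Longrightarrow> card (\<kappa> S) = j \<Longrightarrow> S \<inter> V \<noteq> {}"
    using obtain_core_transversal[OF assms] by blast
  have "{S\<in>level. S \<inter> V \<noteq> {}} = level" using hit by (auto simp: level_def)
  then have "card level \<le> (\<Sum>v\<in>V. card (containing level {v}))"
    using card_hitting_le[OF V(1), of level] finite_F by (simp add: level_def)
  then have "real (card level) \<le> real (\<Sum>v\<in>V. card (containing level {v}))" by (rule of_nat_mono)
  also have "\<dots> = (\<Sum>v\<in>V. real (card (containing level {v})))" by simp
  also have "\<dots> \<le> real (card V) * \<Delta> j"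
  proof (rule sum_bounded_above)
    fix v
    have "card (containing level {v}) \<le> card {S\<in>containing F {v}. j \<le> card (\<kappa> S)}"
      by (intro card_mono) (auto simp: level_def containing_def finite_F)
    then show "real (card (containing level {v})) \<le> \<Delta> j"
      using core_assignmentD(4)[OF \<kappa>, of v j] by linarith
  qed
  also have "\<dots> \<le> real ((s - 1 - card H) * j) * \<Delta> j"
    using V(2) \<Delta>_nonneg by (intro mult_right_mono of_nat_mono)
  finally show ?thesis by (simp add: level_def mult.assoc)
qed

lemma card_large_cores_le: "real (card {S\<in>F. b < card (\<kappa> S)}) \<le> real (card X) * \<Delta> (Suc b)"
proof -
  let ?large = "{S\<in>F. b < card (\<kappa> S)}"
  have "S \<inter> X \<noteq> {}" if "S \<in> F" for S
    using that F_subset empty_notin by (metis Int_absorb2 PowD subsetD)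
  then have "{S\<in>?large. S \<inter> X \<noteq> {}} = ?large" by auto
  then have "card ?large \<le> (\<Sum>v\<in>X. card (containing ?large {v}))"
    using card_hitting_le[OF finite_X, of ?large] finite_F by simp
  then have "real (card ?large) \<le> real (\<Sum>v\<in>X. card (containing ?large {v}))" by (rule of_nat_mono)
  also have "\<dots> = (\<Sum>v\<in>X. real (card (containing ?large {v})))" by simp
  also have "\<dots> \<le> real (card X) * \<Delta> (Suc b)"
  proof (rule sum_bounded_above)
    fix v
    have "containing ?large {v} = {S\<in>containing F {v}. Suc b \<le> card (\<kappa> S)}"
      by (auto simp: containing_def)
    then show "real (card (containing ?large {v})) \<le> \<Delta> (Suc b)"
      using core_assignmentD(4)[OF \<kappa>] by simp
  qed
  finally show ?thesis .
qed

lemma card_avoiding_singleton_cores_le: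
  "real (card {S\<in>F. S \<inter> H = {}})
    \<le> real (s - 1 - card H) * (\<Sum>j=2..b. real j * \<Delta> j) + real (card X) * \<Delta> (Suc b)"
proof -
  let ?level = "\<lambda>j. {S\<in>F. S \<inter> H = {} \<and> card (\<kappa> S) = j}"
  let ?large = "{S\<in>F. b < card (\<kappa> S)}"
  have "{S\<in>F. S \<inter> H = {}} \<subseteq> ?large \<union> (\<Union>j\<in>{2..b}. ?level j)"
  proof
    fix S assume S: "S \<in> {S\<in>F. S \<inter> H = {}}"
    have "card (\<kappa> S) \<noteq> 0" using S core_assignmentD(1)[OF \<kappa>, of S] finite_core by simp
    moreover have "card (\<kappa> S) \<noteq> 1"
    proof
      assume "card (\<kappa> S) = 1"
      then obtain v where v: "\<kappa> S = {v}" by (rule card_1_singletonE)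
      then have "v \<in> H"
        using S unfolding singleton_cores_def by (metis (mono_tags) CollectD CollectI imageI)
      then show False using S v core_assignmentD(2)[OF \<kappa>, of S] by auto
    qed
    ultimately show "S \<in> ?large \<union> (\<Union>j\<in>{2..b}. ?level j)" using S by auto
  qed
  then have "card {S\<in>F. S \<inter> H = {}} \<le> card (?large \<union> (\<Union>j\<in>{2..b}. ?level j))"
    using finite_F by (intro card_mono) auto
  also have "\<dots> \<le> card ?large + card (\<Union>j\<in>{2..b}. ?level j)" by (rule card_Un_le)
  also have "card (\<Union>j\<in>{2..b}. ?level j) \<le> (\<Sum>j=2..b. card (?level j))" by (rule card_UN_le) simp
  finally have "real (card {S\<in>F. S \<inter> H = {}}) \<le> real (card ?large + (\<Sum>j=2..b. card (?level j)))"
    by (rule of_nat_mono) simp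
  also have "\<dots> = real (card ?large) + (\<Sum>j=2..b. real (card (?level j)))" by simp
  also have "(\<Sum>j=2..b. real (card (?level j))) \<le> (\<Sum>j=2..b. real (s - 1 - card H) * (real j * \<Delta> j))"
    by (intro sum_mono card_avoiding_core_size_le) simp
  finally show ?thesis using card_large_cores_le by (simp add: sum_distrib_left)
qed

end

theorem obtain_small_set_meeting_most:
  fixes \<Delta> :: "nat \<Rightarrow> real"
  assumes "antimono \<Delta>" "\<And>j. 0 \<le> \<Delta> j"
    and "\<And>Y. Y \<subseteq> X \<Longrightarrow> Y \<noteq> {} \<Longrightarrow> real (card (containing F Y)) * r ^ (card Y - 1) \<le> \<Delta> (card Y)"
  obtains H where "H \<subseteq> X" "card H < s"
    "real (card {S\<in>F. S \<inter> H = {}})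
      \<le> real (s - 1 - card H) * (\<Sum>j=2..b. real j * \<Delta> j) + real (card X) * \<Delta> (Suc b)"
proof -
  have "0 < real s * real b" using s_pos b_pos by simp
  then have "0 < r" using r_ge by linarith
  then obtain \<kappa> where "core_assignment r \<Delta> F \<kappa>"
    using core_assignment_exists[OF finite_X F_subset empty_notin _ assms] by blast
  note singleton_cores_subset[OF this assms(2)] card_singleton_cores_less[OF this assms(2)]
    card_avoiding_singleton_cores_le[OF this assms(2)]
  then show ?thesis by (rule that)
qed

end

section \<open>Counting permutations\<close>

lemma bij_betw_permutes_agreeing:
  assumes "p permutes A" "B \<subseteq> A"
  shows "bij_betw (\<lambda>q. p \<circ> q) {q. q permutes A - B} {q. q permutes A \<and> (\<forall>i\<in>B. q i = p i)}"
proof (rule bij_betw_byWitness[where f' = "\<lambda>q. inv p \<circ> q"])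
  have inv: "inv p \<circ> p = id" "p \<circ> inv p = id"
    using permutes_inv_o[OF assms(1)] by auto
  show "\<forall>q\<in>{q. q permutes A - B}. inv p \<circ> (p \<circ> q) = q"
    "\<forall>q\<in>{q. q permutes A \<and> (\<forall>i\<in>B. q i = p i)}. p \<circ> (inv p \<circ> q) = q"
    using inv by (simp_all add: o_assoc)
  show "(\<lambda>q. p \<circ> q) ` {q. q permutes A - B} \<subseteq> {q. q permutes A \<and> (\<forall>i\<in>B. q i = p i)}"
  proof clarify
    fix q assume q: "q permutes A - B"
    have "q permutes A" by (rule permutes_subset[OF q]) auto
    then have "p \<circ> q permutes A" using assms(1) by (rule permutes_compose)
    moreover have "q i = i" if "i \<in> B" for i using q that unfolding permutes_def by auto
    ultimately show "p \<circ> q permutes A \<and> (\<forall>i\<in>B. (p \<circ> q) i = p i)" by simp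
  qed
  show "(\<lambda>q. inv p \<circ> q) ` {q. q permutes A \<and> (\<forall>i\<in>B. q i = p i)} \<subseteq> {q. q permutes A - B}"
  proof clarify
    fix q assume q: "q permutes A" "\<forall>i\<in>B. q i = p i"
    have "inv p \<circ> q permutes A" using q(1) permutes_inv[OF assms(1)] by (rule permutes_compose)
    then show "inv p \<circ> q permutes A - B"
      by (rule permutes_superset) (use q(2) permutes_inverses(2)[OF assms(1)] in auto)
  qed
qed

lemma card_permutes_agreeing:
  assumes "finite A" "p permutes A" "B \<subseteq> A"
  shows "card {q. q permutes A \<and> (\<forall>i\<in>B. q i = p i)} = fact (card A - card B)"
  using assms bij_betw_same_card[OF bij_betw_permutes_agreeing[OF assms(2,3)]]
    card_permutations[of "A - B"]
  by (simp add: card_Diff_subset finite_subset)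

lemma card_permutes_at_le:
  assumes "finite A" "i \<in> A"
  shows "card {\<pi>. \<pi> permutes A \<and> \<pi> i = v} \<le> fact (card A - 1)"
proof (cases "v \<in> A")
  case True
  then show ?thesis
    using card_permutes_agreeing[OF assms(1) permutes_swap_id[OF assms(2) True], of "{i}"] assms(2)
    by simp
next
  case False
  then have "{\<pi>. \<pi> permutes A \<and> \<pi> i = v} = {}" using assms(2) permutes_in_image by fastforce
  then show ?thesis by (metis card.empty le0)
qed

lemma exists_permutes_two_points:
  assumes "a \<in> A" "b \<in> A" "c \<in> A" "d \<in> A" "a \<noteq> b" "c \<noteq> d"
  shows "\<exists>p. p permutes A \<and> p a = c \<and> p b = d"
proof (intro exI conjI)
  let ?t = "transpose a c"
  have t: "?t b \<in> A" "?t b \<noteq> c" using assms by (auto simp: transpose_def)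
  show "transpose (?t b) d \<circ> ?t permutes A"
    using assms t by (intro permutes_compose permutes_swap_id)
  show "(transpose (?t b) d \<circ> ?t) a = c" "(transpose (?t b) d \<circ> ?t) b = d"
    using assms t(2) by (simp_all add: transpose_apply_other)
qed

locale forbidden_values =
  fixes A :: "'a set" and B :: "'a \<Rightarrow> 'a set" and d :: nat
  assumes finite_A: "finite A" and finite_B: "\<And>i. i \<in> A \<Longrightarrow> finite (B i)"
    and card_row_le: "\<And>i. i \<in> A \<Longrightarrow> card (B i) \<le> d"
    and card_column_le: "\<And>v. v \<in> A \<Longrightarrow> card {i\<in>A. v \<in> B i} \<le> d"
begin

definition hits :: "('a \<Rightarrow> 'a) \<Rightarrow> 'a set" where
  "hits \<pi> = {i\<in>A. \<pi> i \<in> B i}"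

definition level :: "nat \<Rightarrow> ('a \<Rightarrow> 'a) set" where
  "level j = {\<pi>. \<pi> permutes A \<and> card (hits \<pi>) = j}"

lemma finite_hits: "finite (hits \<pi>)"
  using finite_A by (simp add: hits_def)

lemma finite_permutes: "finite {\<pi>. \<pi> permutes A \<and> P \<pi>}"
  by (rule finite_subset[OF _ finite_permutations[OF finite_A]]) auto

lemma finite_level: "finite (level j)"
  unfolding level_def by (rule finite_permutes)

lemma sum_card_hits_le: "(\<Sum>\<pi>\<in>{\<pi>. \<pi> permutes A}. card (hits \<pi>)) \<le> d * fact (card A)"
proof -
  have "card {\<pi>\<in>{\<pi>. \<pi> permutes A}. \<pi> i \<in> B i} \<le> d * fact (card A - 1)" if i: "i \<in> A" for i
  proof -
    have "card {\<pi>\<in>{\<pi>. \<pi> permutes A}. \<pi> i \<in> B i} \<le> card (\<Union>v\<in>B i. {\<pi>. \<pi> permutes A \<and> \<pi> i = v})"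
      using finite_B[OF i] finite_permutes by (intro card_mono) auto
    also have "\<dots> \<le> (\<Sum>v\<in>B i. card {\<pi>. \<pi> permutes A \<and> \<pi> i = v})"
      using finite_B[OF i] by (rule card_UN_le)
    also have "\<dots> \<le> (\<Sum>v\<in>B i. fact (card A - 1))"
      by (intro sum_mono card_permutes_at_le finite_A i)
    also have "\<dots> \<le> d * fact (card A - 1)" using card_row_le[OF i] by simp
    finally show ?thesis .
  qed
  then have "(\<Sum>i\<in>A. card {\<pi>\<in>{\<pi>. \<pi> permutes A}. \<pi> i \<in> B i}) \<le> (\<Sum>i\<in>A. d * fact (card A - 1))"
    by (rule sum_mono)
  moreover have "(\<Sum>\<pi>\<in>{\<pi>. \<pi> permutes A}. card (hits \<pi>))
      = (\<Sum>i\<in>A. card {\<pi>\<in>{\<pi>. \<pi> permutes A}. \<pi> i \<in> B i})"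
    unfolding hits_def using finite_A finite_permutations by (intro sum_multicount_gen) auto
  moreover have "(\<Sum>i\<in>A. d * fact (card A - 1)) \<le> d * fact (card A)"
    by (cases "card A") (simp_all add: algebra_simps)
  ultimately show ?thesis by linarith
qed

lemma card_preimage_le:
  assumes "\<pi> permutes A" "i \<in> A"
  shows "card {l\<in>A. \<pi> l \<in> B i} \<le> d"
proof -
  have "card {l\<in>A. \<pi> l \<in> B i} \<le> card (B i)"
    by (rule card_inj_on_le[of \<pi>])
      (use inj_on_subset[OF permutes_inj[OF assms(1)]] finite_B[OF assms(2)] in auto)
  then show ?thesis using card_row_le[OF assms(2)] by linarith
qed

definition partners :: "('a \<Rightarrow> 'a) \<Rightarrow> 'a \<Rightarrow> 'a set" where
  "partners \<pi> i = {l\<in>A. l \<notin> hits \<pi> \<and> \<pi> l \<notin> B i \<and> \<pi> i \<notin> B l}"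

lemma card_partners_ge:
  assumes "\<pi> permutes A" "i \<in> A"
  shows "card A - (card (hits \<pi>) + 2 * d) \<le> card (partners \<pi> i)"
proof -
  have "A \<subseteq> partners \<pi> i \<union> (hits \<pi> \<union> ({l\<in>A. \<pi> l \<in> B i} \<union> {l\<in>A. \<pi> i \<in> B l}))"
    by (auto simp: partners_def)
  then have "card A \<le> card (partners \<pi> i \<union> (hits \<pi> \<union> ({l\<in>A. \<pi> l \<in> B i} \<union> {l\<in>A. \<pi> i \<in> B l})))"
    using finite_A finite_hits by (intro card_mono) (auto simp: partners_def)
  also have "\<dots> \<le> card (partners \<pi> i)
      + (card (hits \<pi>) + (card {l\<in>A. \<pi> l \<in> B i} + card {l\<in>A. \<pi> i \<in> B l}))"
    by (meson add_le_mono card_Un_le le_refl le_trans)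
  finally show ?thesis
    using card_preimage_le[OF assms] card_column_le[of "\<pi> i"] assms(2)
      permutes_in_image[OF assms(1)]
    by simp
qed

lemma switch_in_level:
  assumes "\<pi> \<in> level (Suc j)" "i \<in> hits \<pi>" "l \<in> partners \<pi> i"
  shows "\<pi> \<circ> transpose i l \<in> level j"
proof -
  have il: "i \<in> A" "l \<in> A" using assms(2,3) by (auto simp: hits_def partners_def)
  have "hits (\<pi> \<circ> transpose i l) = hits \<pi> - {i}"
    using assms(2,3) unfolding hits_def partners_def by (auto simp: transpose_def)
  then have "card (hits (\<pi> \<circ> transpose i l)) = j"
    using assms(1,2) finite_hits by (simp add: level_def)
  moreover have "\<pi> \<circ> transpose i l permutes A"
    using assms(1) permutes_swap_id[OF il] by (auto simp: level_def intro: permutes_compose)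
  ultimately show ?thesis by (simp add: level_def)
qed

definition switch :: "('a \<Rightarrow> 'a) \<times> 'a \<times> 'a \<Rightarrow> ('a \<Rightarrow> 'a) \<times> 'a \<times> 'a" where
  "switch = (\<lambda>(\<pi>, i, l). (\<pi> \<circ> transpose i l, i, l))"

lemma inj_switch: "inj switch"
proof (rule injI)
  fix x y assume eq: "switch x = switch y"
  obtain \<pi> i l \<tau> i' l' where xy: "x = (\<pi>, i, l)" "y = (\<tau>, i', l')" by (metis prod_cases3)
  then have il: "i' = i" "l' = l" and "\<pi> \<circ> transpose i l = \<tau> \<circ> transpose i l"
    using eq by (auto simp: switch_def)
  then have "\<pi> \<circ> (transpose i l \<circ> transpose i l) = \<tau> \<circ> (transpose i l \<circ> transpose i l)"
    by (metis comp_assoc)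
  then show "x = y" using xy il by simp
qed

text \<open>Double counting of the switchings that exchange the values at a hit \<open>i\<close> and at a non-hit \<open>l\<close>
  and thereby destroy exactly one hit.\<close>

lemma card_level_Suc_mult_le:
  "card (level (Suc j)) * (Suc j * (card A - (Suc j + 2 * d))) \<le> card (level j) * (card A * d)"
proof -
  define switchings where "switchings = (SIGMA \<pi>:level (Suc j). SIGMA i:hits \<pi>. partners \<pi> i)"
  define images where "images = (SIGMA \<pi>:level j. SIGMA i:A. {l\<in>A. \<pi> l \<in> B i})"
  have level: "\<pi> permutes A" "card (hits \<pi>) = i" if "\<pi> \<in> level i" for \<pi> i
    using that by (auto simp: level_def)
  have finite_partners: "finite (partners \<pi> i)" for \<pi> i using finite_A by (simp add: partners_def)
  have "card (level (Suc j)) * (Suc j * (card A - (Suc j + 2 * d)))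
      = (\<Sum>\<pi>\<in>level (Suc j). \<Sum>i\<in>hits \<pi>. card A - (card (hits \<pi>) + 2 * d))"
    using level(2) by simp
  also have "\<dots> \<le> (\<Sum>\<pi>\<in>level (Suc j). \<Sum>i\<in>hits \<pi>. card (partners \<pi> i))"
    using level(1) by (intro sum_mono card_partners_ge) (auto simp: hits_def)
  also have "\<dots> = card switchings"
    unfolding switchings_def using finite_level finite_hits finite_partners
    by (simp add: card_SigmaI)
  also have "\<dots> = card (switch ` switchings)"
    by (rule card_image[symmetric]) (rule inj_on_subset[OF inj_switch subset_UNIV])
  also have "\<dots> \<le> card images"
  proof (rule card_mono)
    show "finite images" unfolding images_def using finite_level finite_A by auto
    show "switch ` switchings \<subseteq> images"
      using switch_in_level
      by (auto simp: switch_def switchings_def images_def hits_def partners_def)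
  qed
  also have "\<dots> = (\<Sum>\<pi>\<in>level j. \<Sum>i\<in>A. card {l\<in>A. \<pi> l \<in> B i})"
    unfolding images_def using finite_level finite_A by (simp add: card_SigmaI)
  also have "\<dots> \<le> (\<Sum>\<pi>\<in>level j. \<Sum>i\<in>A. d)"
    by (intro sum_mono card_preimage_le level(1))
  finally show ?thesis by simp
qed

lemma card_level_Suc_le:
  assumes "20 * card A \<le> 21 * (card A - (Suc j + 2 * d))" "A \<noteq> {}"
  shows "20 * (Suc j * card (level (Suc j))) \<le> 21 * (d * card (level j))"
proof -
  let ?m = "card A - (Suc j + 2 * d)"
  have "20 * (Suc j * card (level (Suc j))) * ?m = 20 * (card (level (Suc j)) * (Suc j * ?m))"
    by (simp only: mult_ac)
  also have "\<dots> \<le> 20 * (card (level j) * (card A * d))"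
    using card_level_Suc_mult_le by (rule mult_le_mono2)
  also have "\<dots> = card (level j) * d * (20 * card A)" by simp
  also have "\<dots> \<le> card (level j) * d * (21 * ?m)" using assms(1) by (rule mult_le_mono2)
  finally have "20 * (Suc j * card (level (Suc j))) * ?m \<le> 21 * (d * card (level j)) * ?m"
    by (simp add: mult_ac)
  moreover have "0 < card A" using assms(2) finite_A by (simp add: card_gt_0_iff)
  then have "0 < ?m" using assms(1) by linarith
  ultimately show ?thesis by simp
qed

text \<open>Levels 1 and 2 have at most 2.1 and 2.205 times the size of level 0, and by Markov's
  inequality at most two thirds of all permutations have three or more hits.\<close>

lemma card_level_0_ge:
  assumes "d = 2" "126 \<le> card A"
  shows "fact (card A) \<le> 16 * card (level 0)"
proof -
  define many where "many = {\<pi>. \<pi> permutes A \<and> 3 \<le> card (hits \<pi>)}"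
  have finite_many: "finite many" unfolding many_def by (rule finite_permutes)
  have "A \<noteq> {}" using assms(2) by auto
  then have "20 * (Suc j * card (level (Suc j))) \<le> 21 * (2 * card (level j))" if "j \<le> 1" for j
    using card_level_Suc_le[of j] assms that by simp
  from this[of 0] this[of 1] have "10 * card (level 1) \<le> 21 * card (level 0)"
    "20 * card (level 2) \<le> 21 * card (level 1)" by (simp_all add: numeral_2_eq_2)
  moreover have "3 * card many \<le> 2 * fact (card A)"
  proof -
    have "3 * card many = (\<Sum>\<pi>\<in>many. 3)" by simp
    also have "\<dots> \<le> (\<Sum>\<pi>\<in>many. card (hits \<pi>))" by (intro sum_mono) (auto simp: many_def)
    also have "\<dots> \<le> (\<Sum>\<pi>\<in>{\<pi>. \<pi> permutes A}. card (hits \<pi>))"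
      using finite_permutations[OF finite_A] by (intro sum_mono2) (auto simp: many_def)
    also have "\<dots> \<le> 2 * fact (card A)" using sum_card_hits_le assms(1) by simp
    finally show ?thesis .
  qed
  moreover have "fact (card A) \<le> card (level 0) + (card (level 1) + (card (level 2) + card many))"
  proof -
    have "\<pi> \<in> level 0 \<union> (level 1 \<union> (level 2 \<union> many))" if "\<pi> permutes A" for \<pi>
      using that by (auto simp: level_def many_def)
    then have "card {\<pi>. \<pi> permutes A} \<le> card (level 0 \<union> (level 1 \<union> (level 2 \<union> many)))"
      using finite_level finite_many by (intro card_mono) auto
    also have "\<dots> \<le> card (level 0) + (card (level 1) + (card (level 2) + card many))"
      by (meson add_le_mono card_Un_le le_refl le_trans)
    finally show ?thesis by (simp add: card_permutations[OF refl finite_A])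
  qed
  ultimately show ?thesis by linarith
qed

end

lemma card_permutes_avoiding_two_ge:
  assumes "finite A" "126 \<le> card A" "inj_on f A" "inj_on g A"
  shows "fact (card A) \<le> 16 * card {\<pi>. \<pi> permutes A \<and> (\<forall>i\<in>A. \<pi> i \<noteq> f i \<and> \<pi> i \<noteq> g i)}"
proof -
  interpret forbidden_values A "\<lambda>i. {f i, g i}" 2
  proof
    have fibre: "card {i\<in>A. h i = v} \<le> 1" if "inj_on h A" for h :: "'a \<Rightarrow> 'a" and v
      using that assms(1) by (auto simp: card_le_Suc0_iff_eq inj_on_def)
    show "card {i\<in>A. v \<in> {f i, g i}} \<le> 2" for v
    proof -
      have "{i\<in>A. v \<in> {f i, g i}} = {i\<in>A. f i = v} \<union> {i\<in>A. g i = v}" by auto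
      then have "card {i\<in>A. v \<in> {f i, g i}} \<le> card {i\<in>A. f i = v} + card {i\<in>A. g i = v}"
        by (simp add: card_Un_le)
      then show ?thesis using fibre[OF assms(3), of v] fibre[OF assms(4), of v] by linarith
    qed
  qed (use assms(1) in \<open>auto simp: card_insert_if\<close>)
  have "level 0 = {\<pi>. \<pi> permutes A \<and> (\<forall>i\<in>A. \<pi> i \<noteq> f i \<and> \<pi> i \<noteq> g i)}"
    using finite_hits by (auto simp: level_def hits_def)
  then show ?thesis using card_level_0_ge[OF refl assms(2)] by simp
qed

lemma card_permutes_agreeing_avoiding_two_ge:
  assumes "finite A" "p permutes A" "B \<subseteq> A" "126 \<le> card A - card B"
    "inj_on f (A - B)" "inj_on g (A - B)"
  shows "fact (card A - card B) \<le> 16 * card {\<pi>. \<pi> permutes A \<and> (\<forall>i\<in>B. \<pi> i = p i)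
    \<and> (\<forall>i\<in>A - B. \<pi> i \<noteq> f i \<and> \<pi> i \<noteq> g i)}"
proof -
  let ?extensions = "{\<pi>. \<pi> permutes A \<and> (\<forall>i\<in>B. \<pi> i = p i)
    \<and> (\<forall>i\<in>A - B. \<pi> i \<noteq> f i \<and> \<pi> i \<noteq> g i)}"
  define avoiding where "avoiding = {q. q permutes A - B
    \<and> (\<forall>i\<in>A - B. q i \<noteq> inv p (f i) \<and> q i \<noteq> inv p (g i))}"
  have card_AB: "card (A - B) = card A - card B"
    using assms(1,3) by (intro card_Diff_subset) (auto intro: finite_subset)
  have "inj (inv p)" using permutes_inj[OF permutes_inv[OF assms(2)]] .
  then have "inj_on (\<lambda>i. inv p (f i)) (A - B)" "inj_on (\<lambda>i. inv p (g i)) (A - B)"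
    using assms(5,6) by (auto simp: inj_on_def dest: injD)
  then have "fact (card (A - B)) \<le> 16 * card avoiding"
    unfolding avoiding_def using assms(1,4) card_AB by (intro card_permutes_avoiding_two_ge) auto
  moreover have "card avoiding \<le> card ?extensions"
  proof (rule card_inj_on_le)
    note bij = bij_betw_permutes_agreeing[OF assms(2,3)]
    show "inj_on (\<lambda>q. p \<circ> q) avoiding"
      using bij_betw_imp_inj_on[OF bij] by (auto simp: avoiding_def elim: inj_on_subset)
    have "p (q i) \<noteq> f i \<and> p (q i) \<noteq> g i" if "q \<in> avoiding" "i \<in> A - B" for q i
    proof -
      have "q i \<noteq> inv p (f i)" "q i \<noteq> inv p (g i)" using that by (auto simp: avoiding_def)
      then show ?thesis using permutes_inverses(2)[OF assms(2)] by metis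
    qed
    then show "(\<lambda>q. p \<circ> q) ` avoiding \<subseteq> ?extensions"
      using bij_betwE[OF bij] by (auto simp: avoiding_def)
    show "finite ?extensions"
      by (rule finite_subset[OF _ finite_permutations[OF assms(1)]]) auto
  qed
  ultimately show ?thesis using card_AB by simp
qed

lemma power_div_3_le_fact: "(real j / 3) ^ j \<le> fact j"
proof -
  have "(\<Sum>i\<in>{j}. real j ^ i /\<^sub>R fact i) \<le> (\<Sum>i. real j ^ i /\<^sub>R fact i)"
    by (intro sum_le_suminf summable_exp_generic) auto
  then have "real j ^ j / fact j \<le> exp (real j)"
    by (simp add: exp_def divide_inverse_commute)
  also have "\<dots> = exp 1 ^ j" by (simp flip: exp_of_nat_mult)
  also have "\<dots> \<le> 3 ^ j" by (intro power_mono exp_le) auto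
  finally show ?thesis by (simp add: power_divide field_simps)
qed

lemma fact_diff_mult_power_le:
  assumes "j \<le> m"
  shows "fact (m - j) * (real m / 3) ^ j \<le> fact m"
proof -
  have "(real m / 3) ^ j \<le> fact j * real (m choose j)"
  proof (cases "j = 0")
    case False
    have "(real m / 3) ^ j = (real j / 3 * (real m / real j)) ^ j" using False by simp
    also have "\<dots> = (real j / 3) ^ j * (real m / real j) ^ j" by (rule power_mult_distrib)
    also have "\<dots> \<le> fact j * real (m choose j)"
      using assms by (intro mult_mono power_div_3_le_fact binomial_ge_n_over_k_pow_k) auto
    finally show ?thesis .
  qed simp
  then have "fact (m - j) * (real m / 3) ^ j \<le> fact (m - j) * (fact j * real (m choose j))"
    by (rule mult_left_mono) simp
  also have "\<dots> = real (fact j * fact (m - j) * (m choose j))" by simp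
  also have "\<dots> = fact m" using binomial_fact_lemma[OF assms] by simp
  finally show ?thesis .
qed

definition perm_graph :: "nat \<Rightarrow> (nat \<Rightarrow> nat) \<Rightarrow> (nat \<times> nat) set" where
  "perm_graph n \<pi> = (\<lambda>i. (i, \<pi> i)) ` {1..n}"

lemma mem_perm_graph [simp]: "(i, j) \<in> perm_graph n \<pi> \<longleftrightarrow> i \<in> {1..n} \<and> \<pi> i = j"
  unfolding perm_graph_def by auto

lemma finite_perm_graph [simp]: "finite (perm_graph n \<pi>)"
  by (simp add: perm_graph_def)

lemma card_perm_graph [simp]: "card (perm_graph n \<pi>) = n"
  unfolding perm_graph_def by (subst card_image) (auto simp: inj_on_def)

lemma perm_graph_subset: "\<pi> permutes {1..n} \<Longrightarrow> perm_graph n \<pi> \<subseteq> {1..n} \<times> {1..n}"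
  unfolding perm_graph_def by (auto dest: permutes_in_image)

lemma inj_on_perm_graph: "inj_on (perm_graph n) {\<pi>. \<pi> permutes {1..n}}"
proof (rule inj_onI, rule ext)
  fix \<pi> \<tau> i assume perms: "\<pi> \<in> {\<pi>. \<pi> permutes {1..n}}" "\<tau> \<in> {\<pi>. \<pi> permutes {1..n}}"
    and eq: "perm_graph n \<pi> = perm_graph n \<tau>"
  show "\<pi> i = \<tau> i"
  proof (cases "i \<in> {1..n}")
    case True
    then have "(i, \<pi> i) \<in> perm_graph n \<tau>" by (simp flip: eq)
    then show ?thesis by simp
  qed (use perms in \<open>auto simp: permutes_def\<close>)
qed

lemma perm_intersect_iff: "perm_intersect n \<sigma> \<tau> \<longleftrightarrow> perm_graph n \<sigma> \<inter> perm_graph n \<tau> \<noteq> {}"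
  unfolding perm_intersect_def perm_graph_def by auto

definition permutations_through :: "nat \<Rightarrow> (nat \<times> nat) set \<Rightarrow> (nat \<Rightarrow> nat) set" where
  "permutations_through n Y = {\<pi>. \<pi> permutes {1..n} \<and> Y \<subseteq> perm_graph n \<pi>}"

lemma finite_permutations_through: "finite (permutations_through n Y)"
  unfolding permutations_through_def
  by (rule finite_subset[OF _ finite_permutations[of "{1..n}"]]) auto

lemma card_permutations_through_le: "card (permutations_through n Y) \<le> fact (n - card Y)"
proof (cases "permutations_through n Y = {}")
  case False
  then obtain p where p: "p permutes {1..n}" "Y \<subseteq> perm_graph n p"
    by (auto simp: permutations_through_def)
  have mem_Y: "fst z \<in> {1..n} \<and> \<pi> (fst z) = snd z" if "z \<in> Y" "Y \<subseteq> perm_graph n \<pi>" for z \<pi>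
    using that unfolding perm_graph_def by auto
  have "inj_on fst Y" using mem_Y[OF _ p(2)] by (metis inj_onI prod_eqI)
  moreover have "fst ` Y \<subseteq> {1..n}" using mem_Y[OF _ p(2)] by blast
  ultimately have "card {q. q permutes {1..n} \<and> (\<forall>i\<in>fst ` Y. q i = p i)} = fact (n - card Y)"
    using card_permutes_agreeing[OF _ p(1), of "fst ` Y"] by (simp add: card_image)
  moreover have "permutations_through n Y \<subseteq> {q. q permutes {1..n} \<and> (\<forall>i\<in>fst ` Y. q i = p i)}"
    using mem_Y mem_Y[OF _ p(2)] by (auto simp: permutations_through_def)
  then have "card (permutations_through n Y)
      \<le> card {q. q permutes {1..n} \<and> (\<forall>i\<in>fst ` Y. q i = p i)}"
    by (intro card_mono finite_subset[OF _ finite_permutations[of "{1..n}"]]) auto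
  ultimately show ?thesis by simp
qed simp

lemma card_permutations_through_mult_power_le:
  assumes "Y \<noteq> {}"
  shows "real (card (permutations_through n Y)) * (real (n - 1) / 3) ^ (card Y - 1) \<le> fact (n - 1)"
proof (cases "permutations_through n Y = {}")
  case False
  then obtain \<pi> where \<pi>: "Y \<subseteq> perm_graph n \<pi>" by (auto simp: permutations_through_def)
  then have "finite Y" by (rule finite_subset) simp
  then have "0 < card Y" using assms by (simp add: card_gt_0_iff)
  moreover have "card Y \<le> n" using card_mono[OF _ \<pi>] by simp
  ultimately have sizes: "card Y - 1 \<le> n - 1" "n - card Y = n - 1 - (card Y - 1)" by linarith+
  have "real (card (permutations_through n Y)) \<le> real (fact (n - 1 - (card Y - 1)))"
    using card_permutations_through_le[of n Y] sizes(2) by (intro of_nat_mono) simp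
  then have "real (card (permutations_through n Y)) * (real (n - 1) / 3) ^ (card Y - 1)
      \<le> fact (n - 1 - (card Y - 1)) * (real (n - 1) / 3) ^ (card Y - 1)"
    by (intro mult_right_mono) auto
  also have "\<dots> \<le> fact (n - 1)" using sizes(1) by (rule fact_diff_mult_power_le)
  finally show ?thesis .
qed simp

lemma card_containing_perm_graphs_le:
  assumes "K \<subseteq> {\<pi>. \<pi> permutes {1..n}}"
  shows "card (containing (perm_graph n ` K) Y) \<le> card (permutations_through n Y)"
proof -
  have "containing (perm_graph n ` K) Y \<subseteq> perm_graph n ` permutations_through n Y"
    using assms by (auto simp: containing_def permutations_through_def)
  then show ?thesis by (rule surj_card_le[OF finite_permutations_through])
qed

lemma spread_link_perm_graphs:
  assumes K: "K \<subseteq> permutations_through n {p}" and large: "fact (n - 1) \<le> L * real (card K)"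
  shows "spread L (real (n - 1) / 3) (link (perm_graph n ` K) {p})"
  unfolding spread_def
proof
  fix Z
  have perms: "K \<subseteq> {\<pi>. \<pi> permutes {1..n}}" using K by (auto simp: permutations_through_def)
  have card_K: "card (link (perm_graph n ` K) {p}) = card K"
  proof -
    have "containing (perm_graph n ` K) {p} = perm_graph n ` K"
      using K by (intro containing_eq) (auto simp: permutations_through_def)
    then show ?thesis
      unfolding card_link using inj_on_subset[OF inj_on_perm_graph perms] by (simp add: card_image)
  qed
  show "real (card (containing (link (perm_graph n ` K) {p}) Z)) * (real (n - 1) / 3) ^ card Z
      \<le> L * real (card (link (perm_graph n ` K) {p}))"
  proof (cases "p \<in> Z")
    case False
    have "card (containing (link (perm_graph n ` K) {p}) Z)
        \<le> card (permutations_through n (insert p Z))"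
      using False card_containing_perm_graphs_le[OF perms, of "insert p Z"]
      by (simp add: card_containing_link)
    then have "real (card (containing (link (perm_graph n ` K) {p}) Z))
          * (real (n - 1) / 3) ^ card Z
        \<le> real (card (permutations_through n (insert p Z))) * (real (n - 1) / 3) ^ card Z"
      by (intro mult_right_mono) auto
    also have "\<dots> \<le> fact (n - 1)"
    proof -
      have "card (insert p Z) - 1 = card Z" using False by (cases "finite Z") auto
      then show ?thesis using card_permutations_through_mult_power_le[of "insert p Z" n] by simp
    qed
    finally show ?thesis using large card_K by simp
  next
    case True
    have "0 \<le> L * real (card K)" using large order_trans[OF fact_ge_zero] by blast
    then show ?thesis using True card_K by (simp add: card_containing_link)
  qed
qed

section \<open>Families of derangements\<close>

lemma finite_derangements: "finite (derangements n)"
  by (rule finite_subset[OF _ finite_permutations[of "{1..n}"]]) (auto simp: derangements_def)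

lemma finite_derangements_at: "finite (derangements_at n x y)"
  using finite_derangements by (simp add: derangements_at_def)

lemma card_derangements_agreeing_ge:
  assumes "p permutes {1..n}" "B \<subseteq> {1..n}" "\<And>i. i \<in> B \<Longrightarrow> p i \<noteq> i" "126 \<le> n - card B"
  shows "fact (n - card B) \<le> 16 * card {\<pi>\<in>derangements n. \<forall>i\<in>B. \<pi> i = p i}"
proof -
  have "{\<pi>. \<pi> permutes {1..n} \<and> (\<forall>i\<in>B. \<pi> i = p i) \<and> (\<forall>i\<in>{1..n} - B. \<pi> i \<noteq> id i \<and> \<pi> i \<noteq> id i)}
      = {\<pi>\<in>derangements n. \<forall>i\<in>B. \<pi> i = p i}"
    using assms(2,3) by (auto simp: derangements_def)
  then show ?thesis
    using card_permutes_agreeing_avoiding_two_ge[of "{1..n}" p B id id] assms by simp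
qed

lemma fact_le_16_mult_d1:
  assumes "127 \<le> n"
  shows "fact (n - 1) \<le> 16 * d1 n"
proof -
  have "{\<pi>\<in>derangements n. \<forall>i\<in>{1}. \<pi> i = transpose 1 2 i} = derangements_at n 1 2"
    by (auto simp: derangements_at_def)
  then show ?thesis
    using card_derangements_agreeing_ge[of "transpose 1 2" n "{1}"] assms
    by (simp add: d1_def permutes_swap_id)
qed

lemma d1_le_fact:
  assumes "2 \<le> n"
  shows "d1 n \<le> fact (n - 1)"
proof -
  have "derangements_at n 1 2 \<subseteq> {\<pi>. \<pi> permutes {1..n} \<and> \<pi> 1 = 2}"
    using assms by (auto simp: derangements_at_def derangements_def)
  then have "d1 n \<le> card {\<pi>. \<pi> permutes {1..n} \<and> \<pi> 1 = 2}"
    unfolding d1_def by (intro card_mono finite_subset[OF _ finite_permutations[of "{1..n}"]]) auto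
  also have "\<dots> \<le> fact (card {1..n} - 1)" using assms by (intro card_permutes_at_le) auto
  finally show ?thesis by simp
qed

lemma derangements_at_Int_nonempty:
  assumes "128 \<le> n" and "x \<in> {1..n}" "x' \<in> {1..n}" "y \<in> {1..n}" "y' \<in> {1..n}"
    and "x \<noteq> y" "x' \<noteq> y'" "x \<noteq> x'" "y \<noteq> y'"
  shows "derangements_at n x y \<inter> derangements_at n x' y' \<noteq> {}"
proof -
  obtain p where p: "p permutes {1..n}" "p x = y" "p x' = y'"
    using exists_permutes_two_points[OF assms(2,3,4,5,8,9)] by blast
  have "{\<pi>\<in>derangements n. \<forall>i\<in>{x, x'}. \<pi> i = p i} = derangements_at n x y \<inter> derangements_at n x' y'"
    using p by (auto simp: derangements_at_def)
  moreover have "\<And>i. i \<in> {x, x'} \<Longrightarrow> p i \<noteq> i" using p(2,3) assms(6,7) by auto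
  ultimately have "fact (n - 2) \<le> 16 * card (derangements_at n x y \<inter> derangements_at n x' y')"
    using card_derangements_agreeing_ge[OF p(1), of "{x, x'}"] assms(1-3,8)
    by (simp add: numeral_2_eq_2)
  then show ?thesis
    using fact_gt_zero[of "n - 2", where 'a = nat] by (metis card.empty mult_0_right not_le)
qed

lemma conjugate_in_derangements_at:
  assumes "t permutes {1..n}" "\<pi> \<in> derangements_at n x y"
  shows "t \<circ> \<pi> \<circ> inv t \<in> derangements_at n (t x) (t y)"
proof -
  have \<pi>: "\<pi> permutes {1..n}" "\<And>i. i \<in> {1..n} \<Longrightarrow> \<pi> i \<noteq> i" "\<pi> x = y"
    using assms(2) by (auto simp: derangements_at_def derangements_def)
  have "t (\<pi> (inv t i)) \<noteq> i" if "i \<in> {1..n}" for i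
  proof
    assume "t (\<pi> (inv t i)) = i"
    then have "\<pi> (inv t i) = inv t i" using permutes_inv_eq[OF assms(1)] by metis
    moreover have "inv t i \<in> {1..n}"
      using permutes_in_image[OF permutes_inv[OF assms(1)]] that by blast
    ultimately show False using \<pi>(2) by blast
  qed
  moreover have "t \<circ> \<pi> \<circ> inv t permutes {1..n}"
    by (intro permutes_compose permutes_inv assms(1) \<pi>(1))
  ultimately show ?thesis
    using \<pi>(3) permutes_inverses(2)[OF assms(1)] by (simp add: derangements_at_def derangements_def)
qed

lemma card_derangements_at:
  assumes "x \<in> {1..n}" "y \<in> {1..n}" "x \<noteq> y"
  shows "card (derangements_at n x y) = d1 n"
proof -
  have "1 \<in> {1..n}" "2 \<in> {1..n}" using assms by auto
  then obtain t where t: "t permutes {1..n}" "t 1 = x" "t 2 = y"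
    using exists_permutes_two_points[of 1 "{1..n}" 2 x y] assms by auto
  have inv_t: "inv t permutes {1..n}" "inv t x = 1" "inv t y = 2" "inv (inv t) = t"
    using permutes_inv[OF t(1)] permutes_inv_inv[OF t(1)] permutes_inverses(2)[OF t(1)] t(2,3)
    by auto
  have "bij_betw (\<lambda>\<pi>. t \<circ> \<pi> \<circ> inv t) (derangements_at n 1 2) (derangements_at n x y)"
  proof (rule bij_betw_byWitness[where f' = "\<lambda>\<pi>. inv t \<circ> \<pi> \<circ> t"])
    show "\<forall>\<pi>\<in>derangements_at n 1 2. inv t \<circ> (t \<circ> \<pi> \<circ> inv t) \<circ> t = \<pi>"
      "\<forall>\<pi>\<in>derangements_at n x y. t \<circ> (inv t \<circ> \<pi> \<circ> t) \<circ> inv t = \<pi>"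
      using permutes_inverses[OF t(1)] by (simp_all add: fun_eq_iff)
    show "(\<lambda>\<pi>. t \<circ> \<pi> \<circ> inv t) ` derangements_at n 1 2 \<subseteq> derangements_at n x y"
      using conjugate_in_derangements_at[OF t(1)] t(2,3) by blast
    show "(\<lambda>\<pi>. inv t \<circ> \<pi> \<circ> t) ` derangements_at n x y \<subseteq> derangements_at n 1 2"
      using conjugate_in_derangements_at[OF inv_t(1)] inv_t by fastforce
  qed
  then show ?thesis unfolding d1_def by (metis bij_betw_same_card)
qed

lemma card_le_nu:
  assumes "finite F" "M \<subseteq> F" "\<And>\<sigma> \<tau>. \<sigma> \<in> M \<Longrightarrow> \<tau> \<in> M \<Longrightarrow> \<sigma> \<noteq> \<tau> \<Longrightarrow> \<not> perm_intersect n \<sigma> \<tau>"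
  shows "card M \<le> nu n F"
  unfolding nu_def
proof (rule Max_ge)
  show "finite {card M | M. M \<subseteq> F \<and> (\<forall>\<sigma>\<in>M. \<forall>\<tau>\<in>M. \<sigma> \<noteq> \<tau> \<longrightarrow> \<not> perm_intersect n \<sigma> \<tau>)}"
    by (rule finite_subset[of _ "card ` Pow F"]) (use assms(1) in auto)
qed (use assms in auto)

lemma card_UN_permutations_through_pair_le:
  assumes "finite H"
  shows "card (\<Union>q\<in>H - {p}. permutations_through n {p, q}) \<le> card H * fact (n - 2)"
proof -
  have "card (permutations_through n {p, q}) \<le> fact (n - 2)" if "q \<in> H - {p}" for q
  proof -
    have "card {p, q} = 2" using that by auto
    then show ?thesis using card_permutations_through_le[of n "{p, q}"] by simp
  qed
  then have "(\<Sum>q\<in>H - {p}. card (permutations_through n {p, q})) \<le> card (H - {p}) * fact (n - 2)"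
    using sum_bounded_above[of "H - {p}" "\<lambda>q. card (permutations_through n {p, q})" "fact (n - 2)"]
    by simp
  also have "\<dots> \<le> card H * fact (n - 2)" using card_Diff1_le by (rule mult_le_mono1)
  finally show ?thesis
    using card_UN_le[of "H - {p}" "\<lambda>q. permutations_through n {p, q}"] assms by simp
qed

lemma sum_mult_inverse_power_le: "(\<Sum>j=2..q. real j / 100 ^ (j - 1)) \<le> 1 / 32"
proof (cases "1 \<le> q")
  case True
  then have "(\<Sum>j=2..q. real j / 100 ^ (j - 1)) \<le> 1 / 49 - 50 / 49 * (1 / 50) ^ q"
  proof (induction q rule: nat_induct_at_least)
    case (Suc q)
    have "real (Suc q) \<le> 2 ^ q"
      by (metis Suc_leI less_exp of_nat_le_iff of_nat_numeral of_nat_power)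
    then have "real (Suc q) / 100 ^ q \<le> 2 ^ q / 100 ^ q" by (intro divide_right_mono) auto
    also have "\<dots> = (1 / 50) ^ q" by (simp flip: power_divide)
    finally show ?case using Suc by simp
  qed simp
  moreover have "0 \<le> 50 / 49 * (1 / 50 :: real) ^ q" by simp
  ultimately show ?thesis by linarith
qed (simp add: not_le)

lemma card_UN_extremalD:
  assumes "finite I" and A: "\<And>i. i \<in> I \<Longrightarrow> finite (A i)" "\<And>i. i \<in> I \<Longrightarrow> card (A i) \<le> d"
    and extremal: "card I * d \<le> card (\<Union>i\<in>I. A i)"
  shows "\<And>i. i \<in> I \<Longrightarrow> card (A i) = d" "disjoint_family_on A I"
proof -
  have exclusive: "d \<le> card (A i - (\<Union>j\<in>I - {i}. A j))" if i: "i \<in> I" for i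
  proof -
    have "(\<Union>i\<in>I. A i) = (A i - (\<Union>j\<in>I - {i}. A j)) \<union> (\<Union>j\<in>I - {i}. A j)" using i by auto
    then have "card (\<Union>i\<in>I. A i) \<le> card (A i - (\<Union>j\<in>I - {i}. A j)) + card (\<Union>j\<in>I - {i}. A j)"
      by (metis card_Un_le)
    also have "card (\<Union>j\<in>I - {i}. A j) \<le> (\<Sum>j\<in>I - {i}. card (A j))"
      using assms(1) by (intro card_UN_le) auto
    also have "\<dots> \<le> card (I - {i}) * d"
      using sum_bounded_above[of "I - {i}" "\<lambda>j. card (A j)" d] A(2) by simp
    finally have "card I * d \<le> card (A i - (\<Union>j\<in>I - {i}. A j)) + card (I - {i}) * d"
      using extremal by linarith
    moreover have "card I * d = d + card (I - {i}) * d"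
      using card.remove[OF assms(1) i] by simp
    ultimately show ?thesis by linarith
  qed
  then show "card (A i) = d" if "i \<in> I" for i
    using A[OF that] card_mono[of "A i" "A i - (\<Union>j\<in>I - {i}. A j)"] that
    by (meson Diff_subset le_antisym le_trans)
  then have "A i - (\<Union>j\<in>I - {i}. A j) = A i" if "i \<in> I" for i
    using exclusive[OF that] A(1)[OF that] that by (intro card_seteq) auto
  then show "disjoint_family_on A I" unfolding disjoint_family_on_def by blast
qed

lemma obtain_enumeration_UN:
  assumes "finite Z" "Y \<subseteq> Z - {x}" "card Y = m"
  obtains ys where "inj_on ys {1..m}" "\<forall>i\<in>{1..m}. ys i \<in> Z \<and> ys i \<noteq> x"
    "(\<Union>y\<in>Y. f y) = (\<Union>i\<in>{1..m}. f (ys i))"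
proof -
  have "finite Y" using assms(1,2) by (auto intro: finite_subset)
  then obtain ys where ys: "bij_betw ys {1..m} Y"
    using ex_bij_betw_nat_finite_1 assms(3) by metis
  have "(\<Union>y\<in>Y. f y) = (\<Union>i\<in>{1..m}. f (ys i))"
    using bij_betw_imp_surj_on[OF ys] by (metis image_image)
  moreover have "\<forall>i\<in>{1..m}. ys i \<in> Z \<and> ys i \<noteq> x" using assms(2) bij_betwE[OF ys] by blast
  ultimately show ?thesis using that bij_betw_imp_inj_on[OF ys] by blast
qed

locale derangement_family =
  fixes n s :: nat and F :: "(nat \<Rightarrow> nat) set"
  assumes s_pos: "0 < s" and s_le: "real s \<le> real n / (2 ^ 17 * ln (real n))"
    and F_subset: "F \<subseteq> derangements n" and nu_less: "nu n F < s"
begin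

definition b :: nat where
  "b = nat \<lceil>4 * ln (real n)\<rceil>"

lemma ln_n_ge_half: "1 / 2 \<le> ln (real n)"
proof -
  have "n \<noteq> 0" "n \<noteq> 1" using s_pos s_le by (intro notI; simp)+
  then have n: "2 \<le> real n" by simp
  then have "1 / real n \<le> 1 / 2" by (simp add: field_simps)
  moreover have "ln (1 / real n) \<le> 1 / real n - 1" using n by (intro ln_le_minus_one) auto
  moreover have "ln (1 / real n) = - ln (real n)" using n by (simp add: ln_div)
  ultimately show ?thesis by linarith
qed

lemma s_mult_ln_le: "real s * (131072 * ln (real n)) \<le> real n"
  using s_le ln_n_ge_half by (simp add: pos_le_divide_eq)

lemma n_ge: "65536 \<le> real n"
proof -
  have "1 * (131072 * (1 / 2)) \<le> real s * (131072 * ln (real n))"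
    using s_pos ln_n_ge_half by (intro mult_mono) auto
  then show ?thesis using s_mult_ln_le by linarith
qed

lemma n_ge_nat: "65536 \<le> n"
  using n_ge by simp

lemma ln_n_ge: "10 \<le> ln (real n)"
proof -
  have "exp (10 :: real) = exp 1 ^ 10" by (simp flip: exp_of_nat_mult)
  also have "\<dots> \<le> 3 ^ 10" by (intro power_mono exp_le) auto
  also have "\<dots> \<le> real n" using n_ge by simp
  finally show ?thesis using n_ge by (subst ln_ge_iff) auto
qed

lemma b_bounds: "4 * ln (real n) \<le> real b" "real b \<le> 41 / 10 * ln (real n)" "0 < b"
  using ln_n_ge unfolding b_def by linarith+

text \<open>The factor \<open>30000 = 3 * 100 * 100\<close> makes room for the division by 3 in
  \<open>fact_diff_mult_power_le\<close>, the spreadness \<open>100 * s * b\<close> of the cores and the decay \<open>100 ^ (1 - j)\<close>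
  of the degrees.\<close>

lemma s_mult_b_le: "30000 * (real s * real b) \<le> real (n - 1)"
proof -
  have "30000 * (real s * real b) \<le> 30000 * (real s * (41 / 10 * ln (real n)))"
    using b_bounds(2) by (intro mult_left_mono) auto
  also have "\<dots> = 123000 / 131072 * (real s * (131072 * ln (real n)))" by simp
  also have "\<dots> \<le> 123000 / 131072 * real n" using s_mult_ln_le by (intro mult_left_mono) auto
  also have "\<dots> \<le> real n - 1" using n_ge by simp
  also have "\<dots> = real (n - 1)" using n_ge by (simp add: of_nat_diff)
  finally show ?thesis .
qed

lemma s_less_n: "real s < real n"
proof -
  have "real s * 1 \<le> real s * real b" using b_bounds(3) by (intro mult_left_mono) auto
  then show ?thesis using s_mult_b_le s_pos by linarith
qed

lemma three_fifths_power_b_le: "(3 / 5) ^ b \<le> 1 / (real n * real n)"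
proof -
  have "exp (1 / 2 :: real) = exp (1 / 32) ^ 16" by (simp flip: exp_of_nat_mult)
  also have "\<dots> \<le> (1 + 1 / 32 + (1 / 32) ^ 2) ^ 16" by (intro power_mono exp_bound) auto
  also have "\<dots> \<le> 5 / 3" by (simp add: power2_eq_square power_divide)
  finally have "3 / 5 \<le> exp (- (1 / 2) :: real)" by (simp add: exp_minus field_simps)
  then have "(3 / 5) ^ b \<le> exp (- (1 / 2) :: real) ^ b" by (intro power_mono) auto
  also have "\<dots> = exp (- (real b / 2))" by (simp flip: exp_of_nat_mult)
  also have "\<dots> \<le> exp (- (ln (real n) + ln (real n)))" using b_bounds(1) by simp
  also have "\<dots> = inverse (real n * real n)" using n_ge by (simp only: exp_minus exp_add exp_ln)
  also have "\<dots> = 1 / (real n * real n)" by (rule inverse_eq_divide)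
  finally show ?thesis .
qed

lemma s_mult_power_less_1: "real s * ((3 / 5) ^ b * real n) < 1"
proof -
  have "(3 / 5) ^ b * real n \<le> 1 / (real n * real n) * real n"
    using three_fifths_power_b_le by (intro mult_right_mono) auto
  then have "real s * ((3 / 5) ^ b * real n) \<le> real s * (1 / real n)"
    using n_ge by (intro mult_left_mono) auto
  also have "\<dots> < 1" using s_less_n by simp
  finally show ?thesis .
qed

lemma n_power_4_le: "real n ^ 4 \<le> 100 ^ b"
proof -
  have "real n ^ 4 = exp (ln (real n)) ^ 4" using n_ge by simp
  also have "\<dots> = exp (4 * ln (real n))" by (simp flip: exp_of_nat_mult)
  also have "\<dots> \<le> exp (real b)" using b_bounds(1) by simp
  also have "\<dots> = exp 1 ^ b" by (simp flip: exp_of_nat_mult)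
  also have "\<dots> \<le> 100 ^ b" using exp_le by (intro power_mono) auto
  finally show ?thesis .
qed

abbreviation G :: "(nat \<Rightarrow> nat) \<Rightarrow> (nat \<times> nat) set" where "G \<equiv> perm_graph n"
abbreviation grid :: "(nat \<times> nat) set" where "grid \<equiv> {1..n} \<times> {1..n}"
abbreviation D :: real where "D \<equiv> real (d1 n)"

definition star :: "nat \<times> nat \<Rightarrow> (nat \<Rightarrow> nat) set" where
  "star p = {\<pi>\<in>F. p \<in> G \<pi>}"

lemma finite_subset_grid: "H \<subseteq> grid \<Longrightarrow> finite H"
  by (erule finite_subset) simp

lemma F_permutes: "\<pi> \<in> F \<Longrightarrow> \<pi> permutes {1..n}"
  using F_subset unfolding derangements_def by auto

lemma finite_F: "finite F"
  using F_subset finite_derangements by (rule finite_subset)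

lemma finite_star: "finite (star p)"
  unfolding star_def using finite_F by simp

lemma inj_on_G: "inj_on G F"
  by (rule inj_on_subset[OF inj_on_perm_graph]) (use F_permutes in blast)

lemma fact_le_16_mult_D: "fact (n - 1) \<le> 16 * D"
  using of_nat_mono[OF fact_le_16_mult_d1, of n, where 'a = real] n_ge_nat by simp

lemma D_pos: "0 < D"
  using fact_le_16_mult_D fact_gt_zero[of "n - 1", where 'a = real] by linarith

lemma D_le_fact: "D \<le> fact (n - 1)"
  using of_nat_mono[OF d1_le_fact, of n, where 'a = real] n_ge_nat by simp

lemma star_subset: "star p \<subseteq> derangements_at n (fst p) (snd p)"
  using F_subset unfolding star_def derangements_at_def by (cases p) auto

lemma star_off_diagonal:
  assumes "star p \<noteq> {}"
  shows "fst p \<in> {1..n}" "snd p \<in> {1..n}" "fst p \<noteq> snd p"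
proof -
  obtain \<pi> where \<pi>: "\<pi> \<in> F" "p \<in> G \<pi>" using assms unfolding star_def by blast
  then show "fst p \<in> {1..n}" "snd p \<in> {1..n}"
    using perm_graph_subset[OF F_permutes[OF \<pi>(1)]] by auto
  moreover have "\<pi> (fst p) = snd p" using \<pi>(2) by (cases p) simp
  ultimately show "fst p \<noteq> snd p"
    using subsetD[OF F_subset \<pi>(1)] by (auto simp: derangements_def)
qed

lemma card_star_le: "card (star p) \<le> d1 n"
proof (cases "star p = {}")
  case False
  then show ?thesis
    using card_mono[OF finite_derangements_at star_subset] card_derangements_at star_off_diagonal
    by metis
qed simp

lemma card_Diff_star:
  assumes "fst p \<in> {1..n}" "snd p \<in> {1..n}" "fst p \<noteq> snd p"
  shows "real (card (derangements_at n (fst p) (snd p) - star p)) = D - real (card (star p))"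
  using card_Diff_subset[OF finite_star star_subset] card_derangements_at[OF assms] card_star_le
  by (simp add: of_nat_diff)

lemma matching_less:
  assumes M: "M \<subseteq> G ` F" "disjoint M"
  shows "card M < s"
proof -
  obtain N where N: "N \<subseteq> F" "M = G ` N" using M(1) by (meson subset_image_iff)
  have inj: "inj_on G N" using inj_on_G N(1) by (rule inj_on_subset)
  have "card N \<le> nu n F"
  proof (rule card_le_nu[OF finite_F N(1)])
    fix \<sigma> \<tau> assume "\<sigma> \<in> N" "\<tau> \<in> N" "\<sigma> \<noteq> \<tau>"
    then have "G \<sigma> \<in> M" "G \<tau> \<in> M" "G \<sigma> \<noteq> G \<tau>" using N(2) inj by (auto simp: inj_on_def)
    then show "\<not> perm_intersect n \<sigma> \<tau>" using disjointD[OF M(2)] by (simp add: perm_intersect_iff)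
  qed
  then show ?thesis using nu_less card_image[OF inj] N(2) by simp
qed

lemma card_containing_graphs_mult_power_le:
  assumes "Y \<noteq> {}"
  shows "real (card (containing (G ` F) Y)) * (100 * (real s * real b)) ^ (card Y - 1)
    \<le> 16 * D / 100 ^ (card Y - 1)"
proof -
  let ?j = "card Y - 1"
  have "card (containing (G ` F) Y) \<le> card (permutations_through n Y)"
    using F_permutes by (intro card_containing_perm_graphs_le) auto
  moreover have "(100 * (real s * real b)) ^ ?j \<le> (real (n - 1) / 3 / 100) ^ ?j"
    using s_mult_b_le by (intro power_mono) auto
  ultimately have "real (card (containing (G ` F) Y)) * (100 * (real s * real b)) ^ ?j
      \<le> real (card (permutations_through n Y)) * (real (n - 1) / 3 / 100) ^ ?j"
    by (intro mult_mono) auto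
  also have "\<dots> = real (card (permutations_through n Y)) * (real (n - 1) / 3) ^ ?j / 100 ^ ?j"
    by (simp only: power_divide[of "real (n - 1) / 3" 100] times_divide_eq_right)
  also have "\<dots> \<le> 16 * D / 100 ^ ?j"
    using card_permutations_through_mult_power_le[OF assms, of n] fact_le_16_mult_D
    by (intro divide_right_mono) auto
  finally show ?thesis .
qed

lemma obtain_few_centres:
  obtains H where "H \<subseteq> grid" "card H < s"
    "real (card {\<pi>\<in>F. G \<pi> \<inter> H = {}}) \<le> real (s - 1 - card H) * (D / 2) + D / 64"
proof -
  let ?\<Delta> = "\<lambda>j. 16 * D / 100 ^ (j - 1)"
  have "G ` F \<subseteq> Pow grid" using perm_graph_subset F_permutes by blast
  moreover have "{} \<notin> G ` F"
    using card_perm_graph[of n] n_ge_nat by (metis card.empty imageE not_numeral_le_zero)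
  ultimately interpret matching_free_family grid "G ` F" s b n "100 * (real s * real b)"
    using s_pos b_bounds(3) matching_less s_mult_power_less_1 by unfold_locales auto
  have "antimono ?\<Delta>"
    using D_pos by (intro antimonoI divide_left_mono power_increasing) auto
  then obtain H where H: "H \<subseteq> grid" "card H < s" and avoiding:
    "real (card {S\<in>G ` F. S \<inter> H = {}})
      \<le> real (s - 1 - card H) * (\<Sum>j=2..b. real j * ?\<Delta> j) + real (card grid) * ?\<Delta> (Suc b)"
    using obtain_small_set_meeting_most[of ?\<Delta>] card_containing_graphs_mult_power_le by auto
  have "(\<Sum>j=2..b. real j * ?\<Delta> j) = 16 * D * (\<Sum>j=2..b. real j / 100 ^ (j - 1))"
    by (simp add: sum_distrib_left mult_ac)
  also have "\<dots> \<le> 16 * D * (1 / 32)" by (intro mult_left_mono sum_mult_inverse_power_le) simp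
  finally have "(\<Sum>j=2..b. real j * ?\<Delta> j) \<le> D / 2" by simp
  then have "real (s - 1 - card H) * (\<Sum>j=2..b. real j * ?\<Delta> j) \<le> real (s - 1 - card H) * (D / 2)"
    by (intro mult_left_mono) auto
  moreover have "real (card grid) * ?\<Delta> (Suc b) \<le> D / 64"
  proof -
    have "1024 \<le> real n * real n" using n_ge mult_mono[of 65536 "real n" 65536 "real n"] by simp
    then have "real n * real n * 1024 \<le> real n * real n * (real n * real n)"
      by (intro mult_left_mono) auto
    also have "\<dots> \<le> 100 ^ b" using n_power_4_le by (simp add: power4_eq_xxxx mult.assoc)
    finally have "D * (real n * real n * 1024) \<le> D * 100 ^ b" by (intro mult_left_mono) auto
    then show ?thesis by (simp add: card_cartesian_product field_simps)
  qed
  moreover have "{S\<in>G ` F. S \<inter> H = {}} = G ` {\<pi>\<in>F. G \<pi> \<inter> H = {}}" by auto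
  then have "card {S\<in>G ` F. S \<inter> H = {}} = card {\<pi>\<in>F. G \<pi> \<inter> H = {}}"
    using inj_on_subset[OF inj_on_G, of "{\<pi>\<in>F. G \<pi> \<inter> H = {}}"] by (simp add: card_image)
  ultimately show ?thesis using that[OF H] avoiding by linarith
qed

lemma stars_cover: "F = {\<pi>\<in>F. G \<pi> \<inter> H = {}} \<union> (\<Union>p\<in>H. star p)"
  unfolding star_def by auto

lemma card_F_le_sum_stars:
  assumes "finite H"
  shows "card F \<le> card {\<pi>\<in>F. G \<pi> \<inter> H = {}} + (\<Sum>p\<in>H. card (star p))"
proof -
  have "card F \<le> card {\<pi>\<in>F. G \<pi> \<inter> H = {}} + card (\<Union>p\<in>H. star p)"
    using card_Un_le[of "{\<pi>\<in>F. G \<pi> \<inter> H = {}}" "\<Union>p\<in>H. star p"] stars_cover[of H] by simp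
  then show ?thesis using card_UN_le[OF assms, of star] by linarith
qed

lemma card_star_ge:
  assumes "finite H" "p \<in> H" "real (card H) * D \<le> e + (\<Sum>p\<in>H. real (card (star p)))"
  shows "D - e \<le> real (card (star p))"
proof -
  have "(\<Sum>p\<in>H - {p}. real (card (star p))) \<le> real (card (H - {p})) * D"
    using card_star_le by (intro sum_bounded_above) simp
  moreover have "real (card H) = 1 + real (card (H - {p}))"
    using card.remove[OF assms(1,2)] by simp
  moreover have "(\<Sum>p\<in>H. real (card (star p)))
      = real (card (star p)) + (\<Sum>p\<in>H - {p}. real (card (star p)))"
    using assms(1,2) by (rule sum.remove)
  ultimately show ?thesis using assms(3) by (simp add: algebra_simps)
qed

lemma obtain_almost_full_stars:
  assumes large: "(s - 1) * d1 n \<le> card F"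
  obtains H where "H \<subseteq> grid" "card H = s - 1" "\<And>p. p \<in> H \<Longrightarrow> 63 / 64 * D \<le> real (card (star p))"
proof -
  obtain H where H: "H \<subseteq> grid" "card H < s"
    "real (card {\<pi>\<in>F. G \<pi> \<inter> H = {}}) \<le> real (s - 1 - card H) * (D / 2) + D / 64"
    by (rule obtain_few_centres)
  define rest where "rest = {\<pi>\<in>F. G \<pi> \<inter> H = {}}"
  define gap where "gap = s - 1 - card H"
  have finite_H: "finite H" using H(1) by (rule finite_subset_grid)
  have "card F \<le> card rest + (\<Sum>p\<in>H. card (star p))"
    unfolding rest_def using finite_H by (rule card_F_le_sum_stars)
  then have "real ((s - 1) * d1 n) \<le> real (card rest + (\<Sum>p\<in>H. card (star p)))"
    using large by (intro of_nat_mono) linarith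
  moreover have "s - 1 = gap + card H" using H(2) by (simp add: gap_def)
  ultimately have count: "real gap * D + real (card H) * D
      \<le> real (card rest) + (\<Sum>p\<in>H. real (card (star p)))"
    by (simp add: distrib_right)
  have rest_le: "real (card rest) \<le> real gap * D / 2 + D / 64"
    using H(3) by (simp add: rest_def gap_def)
  have "gap = 0"
  proof (rule ccontr)
    assume "gap \<noteq> 0"
    then have "1 * D \<le> real gap * D" by (intro mult_right_mono) auto
    moreover have "(\<Sum>p\<in>H. real (card (star p))) \<le> real (card H) * D"
      using card_star_le by (intro sum_bounded_above) simp
    ultimately show False using count rest_le D_pos by linarith
  qed
  then have "card H = s - 1" using H(2) by (simp add: gap_def)
  moreover have "63 / 64 * D \<le> real (card (star p))" if "p \<in> H" for p
    using card_star_ge[OF finite_H that, of "real (card rest)"] count rest_le \<open>gap = 0\<close> by simp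
  ultimately show ?thesis using that H(1) by blast
qed

definition free_star :: "(nat \<Rightarrow> nat) \<Rightarrow> (nat \<times> nat) set \<Rightarrow> nat \<times> nat \<Rightarrow> (nat \<Rightarrow> nat) set" where
  "free_star \<sigma> H p = {\<pi>\<in>star p. G \<pi> \<inter> G \<sigma> = {} \<and> G \<pi> \<inter> (H - {p}) = {}}"

lemma s_mult_fact_le: "64 * (real s * fact (n - 2)) \<le> fact (n - 1)"
proof -
  have "real s * 1 \<le> real s * real b" using b_bounds(3) by (intro mult_left_mono) auto
  then have "64 * real s \<le> real (n - 1)" using s_mult_b_le by linarith
  then have "64 * real s * fact (n - 2) \<le> real (n - 1) * fact (n - 2)"
    by (intro mult_right_mono) auto
  also have "\<dots> = fact (n - 1)"
    using n_ge_nat fact_reduce[of "n - 1", where 'a = real] by (simp add: numeral_2_eq_2)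
  finally show ?thesis by simp
qed

lemma obtain_avoiding_derangements:
  assumes "\<sigma> permutes {1..n}" "p \<in> grid" "fst p \<noteq> snd p" "p \<notin> G \<sigma>"
  obtains V where "V \<subseteq> derangements_at n (fst p) (snd p)" "\<And>\<pi>. \<pi> \<in> V \<Longrightarrow> G \<pi> \<inter> G \<sigma> = {}"
    "fact (n - 1) \<le> 16 * card V"
proof
  let ?t = "transpose (fst p) (snd p)"
  let ?V = "{\<pi>. \<pi> permutes {1..n} \<and> (\<forall>i\<in>{fst p}. \<pi> i = ?t i)
    \<and> (\<forall>i\<in>{1..n} - {fst p}. \<pi> i \<noteq> id i \<and> \<pi> i \<noteq> \<sigma> i)}"
  have p: "fst p \<in> {1..n}" "snd p \<in> {1..n}" "\<sigma> (fst p) \<noteq> snd p"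
    using assms(2,4) by (cases p; auto)+
  show "?V \<subseteq> derangements_at n (fst p) (snd p)"
    using assms(3) by (auto simp: derangements_at_def derangements_def)
  show "G \<pi> \<inter> G \<sigma> = {}" if "\<pi> \<in> ?V" for \<pi>
    using that p(3) by (force simp: perm_graph_def)
  show "fact (n - 1) \<le> 16 * card ?V"
    using card_permutes_agreeing_avoiding_two_ge[of "{1..n}" ?t "{fst p}" id \<sigma>]
      permutes_swap_id[OF p(1,2)] p(1) permutes_inj_on[OF assms(1)] n_ge_nat by simp
qed

lemma card_free_star_ge:
  assumes H: "H \<subseteq> grid" "card H \<le> s" and \<sigma>: "\<sigma> permutes {1..n}" "G \<sigma> \<inter> H = {}"
    and p: "p \<in> H" "63 / 64 * D \<le> real (card (star p))"
  shows "fact (n - 1) \<le> 32 * real (card (free_star \<sigma> H p))"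
proof -
  define full where "full = derangements_at n (fst p) (snd p)"
  have finite_H: "finite H" using H(1) by (rule finite_subset_grid)
  have "star p \<noteq> {}" using p(2) D_pos by auto
  note off_diagonal = star_off_diagonal[OF this]
  obtain V where V: "V \<subseteq> full" "\<And>\<pi>. \<pi> \<in> V \<Longrightarrow> G \<pi> \<inter> G \<sigma> = {}" "fact (n - 1) \<le> 16 * card V"
    using obtain_avoiding_derangements[OF \<sigma>(1), of p] off_diagonal H(1) p(1) \<sigma>(2) unfolding full_def
    by blast
  have "V \<subseteq> free_star \<sigma> H p \<union> ((full - star p) \<union> (\<Union>q\<in>H - {p}. permutations_through n {p, q}))"
    using V(1,2) F_permutes by (auto simp: free_star_def star_def permutations_through_def)
  moreover have "finite (free_star \<sigma> H p)" "finite full"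
    using finite_star finite_derangements_at by (auto simp: free_star_def full_def)
  ultimately have "card V
      \<le> card (free_star \<sigma> H p \<union> ((full - star p) \<union> (\<Union>q\<in>H - {p}. permutations_through n {p, q})))"
    using finite_H finite_permutations_through by (intro card_mono) auto
  also have "\<dots> \<le> card (free_star \<sigma> H p)
      + (card (full - star p) + card (\<Union>q\<in>H - {p}. permutations_through n {p, q}))"
    by (meson add_le_mono card_Un_le le_refl le_trans)
  finally have "real (card V) \<le> real (card (free_star \<sigma> H p) + (card (full - star p)
      + card (\<Union>q\<in>H - {p}. permutations_through n {p, q})))"
    by (rule of_nat_mono)
  moreover have "real (card (full - star p)) = D - real (card (star p))"
    unfolding full_def by (rule card_Diff_star[OF off_diagonal])
  moreover have "card (\<Union>q\<in>H - {p}. permutations_through n {p, q}) \<le> s * fact (n - 2)"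
    using card_UN_permutations_through_pair_le[OF finite_H, of n p] H(2)
    by (meson le_trans mult_le_mono1)
  then have "real (card (\<Union>q\<in>H - {p}. permutations_through n {p, q})) \<le> real (s * fact (n - 2))"
    by (rule of_nat_mono)
  moreover have "fact (n - 1) \<le> 16 * real (card V)"
    using of_nat_mono[OF V(3), where 'a = real] by simp
  ultimately show ?thesis using s_mult_fact_le D_le_fact p(2) by simp
qed

lemma disjoint_free_stars:
  assumes H: "H \<subseteq> grid" "card H \<le> s"
    and large: "\<And>p. p \<in> H \<Longrightarrow> fact (n - 1) \<le> 32 * real (card (free_star \<sigma> H p))"
  shows "\<exists>R. (\<forall>p\<in>H. R p \<in> G ` free_star \<sigma> H p) \<and> disjoint_family_on R H"
proof -
  have "real (card H) \<le> real s" using H(2) by simp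
  then have "real (card H) * real b \<le> real s * real b"
    "real (card H) * ((3 / 5) ^ b * real n) \<le> real s * ((3 / 5) ^ b * real n)"
    by (intro mult_right_mono; simp)+
  then have "40 * 32 * (real (card H) * real b) \<le> real (n - 1) / 3"
    "real (card H) * ((3 / 5) ^ b * real n) < 1"
    using s_mult_b_le s_mult_power_less_1 by linarith+
  then interpret rainbow_parameters grid H 32 "real (n - 1) / 3" b n
    using finite_subset_grid[OF H(1)] b_bounds(3) by unfold_locales auto
  show ?thesis
  proof (rule rainbow_disjoint_members[where Y = "\<lambda>p. {p}"])
    show "G ` free_star \<sigma> H p \<subseteq> Pow grid" for p
      by (intro image_subsetI PowI perm_graph_subset F_permutes) (simp add: free_star_def star_def)
    show "G ` free_star \<sigma> H p \<noteq> {}" if "p \<in> H" for p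
    proof
      assume "G ` free_star \<sigma> H p = {}"
      then have "fact (n - 1) \<le> (0 :: real)" using large[OF that] by simp
      then show False using fact_gt_zero[of "n - 1", where 'a = real] by linarith
    qed
    show "{p} \<subseteq> S" "card S \<le> n" if "S \<in> G ` free_star \<sigma> H p" for S p
      using that by (auto simp: free_star_def star_def)
    show "S \<inter> {q} = {}" if "p \<in> H" "q \<in> H" "p \<noteq> q" "S \<in> G ` free_star \<sigma> H p" for p q S
      using that by (auto simp: free_star_def)
    show "spread 32 (real (n - 1) / 3) (link (G ` free_star \<sigma> H p) {p})" if "p \<in> H" for p
      using large[OF that] F_permutes
      by (intro spread_link_perm_graphs)
        (auto simp: free_star_def star_def permutations_through_def)
  qed
qed

lemma covered_by_almost_full_stars:
  assumes H: "H \<subseteq> grid" "card H = s - 1"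
    and full: "\<And>p. p \<in> H \<Longrightarrow> 63 / 64 * D \<le> real (card (star p))"
  shows "F = (\<Union>p\<in>H. star p)"
proof (rule ccontr)
  assume "F \<noteq> (\<Union>p\<in>H. star p)"
  then obtain \<sigma> where \<sigma>: "\<sigma> \<in> F" "G \<sigma> \<inter> H = {}" using stars_cover[of H] by blast
  have finite_H: "finite H" using H(1) by (rule finite_subset_grid)
  have "fact (n - 1) \<le> 32 * real (card (free_star \<sigma> H p))" if "p \<in> H" for p
    using H \<sigma>(2) F_permutes[OF \<sigma>(1)] that full by (intro card_free_star_ge) auto
  then have "\<exists>R. (\<forall>p\<in>H. R p \<in> G ` free_star \<sigma> H p) \<and> disjoint_family_on R H"
    using H by (intro disjoint_free_stars) auto
  then obtain R where R: "\<And>p. p \<in> H \<Longrightarrow> R p \<in> G ` free_star \<sigma> H p"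
    and disjoint_R: "disjoint_family_on R H" by metis
  have R_member: "R p \<in> G ` F" "p \<in> R p" "R p \<inter> G \<sigma> = {}" if "p \<in> H" for p
    using R[OF that] by (auto simp: free_star_def star_def)
  then have "disjoint (R ` H) \<and> inj_on R H"
    using disjoint_R disjoint_family_on_iff_disjoint_image[of H R] by blast
  moreover have "G \<sigma> \<notin> R ` H" using R_member by fastforce
  ultimately have "card (insert (G \<sigma>) (R ` H)) = s"
    using finite_H H(2) s_pos by (simp add: card_image)
  moreover have "card (insert (G \<sigma>) (R ` H)) < s"
  proof (rule matching_less)
    show "insert (G \<sigma>) (R ` H) \<subseteq> G ` F" using \<sigma>(1) R_member(1) by blast
    show "disjoint (insert (G \<sigma>) (R ` H))"
      using \<open>disjoint (R ` H) \<and> inj_on R H\<close> R_member(3) by (auto simp: pairwise_insert disjnt_def)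
  qed
  ultimately show False by simp
qed

lemma obtain_covering_stars:
  assumes "(s - 1) * d1 n \<le> card F"
  obtains H where "H \<subseteq> grid" "card H = s - 1" "F = (\<Union>p\<in>H. star p)"
  using obtain_almost_full_stars[OF assms] covered_by_almost_full_stars by metis

lemma card_F_le: "card F \<le> (s - 1) * d1 n"
proof (rule ccontr)
  assume too_large: "\<not> card F \<le> (s - 1) * d1 n"
  then obtain H where H: "H \<subseteq> grid" "card H = s - 1" "F = (\<Union>p\<in>H. star p)"
    using obtain_covering_stars by (metis nle_le)
  have "finite H" using H(1) by (rule finite_subset_grid)
  then have "card (\<Union>p\<in>H. star p) \<le> (\<Sum>p\<in>H. card (star p))" by (rule card_UN_le)
  also have "\<dots> \<le> (s - 1) * d1 n"
    using sum_bounded_above[of H "\<lambda>p. card (star p)" "d1 n"] card_star_le H(2) by simp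
  finally show False using too_large by (simp flip: H(3))
qed

lemma obtain_extremal_centres:
  assumes "card F = (s - 1) * d1 n"
  obtains H where "H \<subseteq> grid" "card H = s - 1" "\<forall>p\<in>H. fst p \<noteq> snd p"
    "\<forall>p\<in>H. \<forall>q\<in>H. fst p = fst q \<or> snd p = snd q"
    "F = (\<Union>p\<in>H. derangements_at n (fst p) (snd p))"
proof -
  obtain H where H: "H \<subseteq> grid" "card H = s - 1" "F = (\<Union>p\<in>H. star p)"
    using obtain_covering_stars assms by (metis le_refl)
  have finite_H: "finite H" using H(1) by (rule finite_subset_grid)
  have "card H * d1 n \<le> card (\<Union>p\<in>H. star p)" using assms H(2) by (simp flip: H(3))
  note extremal = card_UN_extremalD[OF finite_H finite_star card_star_le this]
  have off_diagonal: "fst p \<in> {1..n}" "snd p \<in> {1..n}" "fst p \<noteq> snd p" if "p \<in> H" for p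
    using star_off_diagonal[of p] extremal(1)[OF that] D_pos by fastforce+
  have star_eq: "star p = derangements_at n (fst p) (snd p)" if "p \<in> H" for p
    using extremal(1)[OF that] card_derangements_at[OF off_diagonal[OF that]]
    by (intro card_seteq finite_derangements_at star_subset) simp
  have "fst p = fst q \<or> snd p = snd q" if pq: "p \<in> H" "q \<in> H" for p q
  proof (rule ccontr)
    assume no_line: "\<not> (fst p = fst q \<or> snd p = snd q)"
    then have "star p \<inter> star q \<noteq> {}"
      unfolding star_eq[OF pq(1)] star_eq[OF pq(2)]
      using off_diagonal[OF pq(1)] off_diagonal[OF pq(2)] n_ge_nat
      by (intro derangements_at_Int_nonempty) auto
    moreover have "p \<noteq> q" using no_line by blast
    ultimately show False using disjoint_family_onD[OF extremal(2) pq] by blast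
  qed
  moreover have "F = (\<Union>p\<in>H. derangements_at n (fst p) (snd p))"
    using H(3) star_eq by (metis (no_types, lifting) SUP_cong)
  ultimately show ?thesis using that[OF H(1,2)] off_diagonal(3) by blast
qed

lemma extremal_family_centres:
  assumes "card F = (s - 1) * d1 n"
  shows "(\<exists>x\<in>{1..n}. \<exists>Y\<subseteq>{1..n} - {x}. card Y = s - 1 \<and> F = (\<Union>y\<in>Y. derangements_at n x y))
    \<or> (\<exists>y\<in>{1..n}. \<exists>X\<subseteq>{1..n} - {y}. card X = s - 1 \<and> F = (\<Union>x\<in>X. derangements_at n x y))"
proof -
  obtain H where H: "H \<subseteq> grid" "card H = s - 1" "\<forall>p\<in>H. fst p \<noteq> snd p"
    and lines: "\<forall>p\<in>H. \<forall>q\<in>H. fst p = fst q \<or> snd p = snd q"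
    and F: "F = (\<Union>p\<in>H. derangements_at n (fst p) (snd p))"
    using assms by (rule obtain_extremal_centres)
  consider (empty) "H = {}" | (row) x where "H \<noteq> {}" "\<And>p. p \<in> H \<Longrightarrow> fst p = x"
    | (column) y where "H \<noteq> {}" "\<And>p. p \<in> H \<Longrightarrow> snd p = y"
    using lines by metis
  then show ?thesis
  proof cases
    case empty
    then have "card {} = s - 1" "F = (\<Union>y\<in>{}. derangements_at n 1 y)" "1 \<in> {1..n}"
      using H(2) F n_ge_nat by auto
    then show ?thesis by blast
  next
    case row
    have "x \<in> {1..n}" "snd ` H \<subseteq> {1..n} - {x}" using row H(1,3) by fastforce+
    moreover have "inj_on snd H" using row(2) by (metis inj_onI prod_eqI)
    then have "card (snd ` H) = s - 1" using H(2) by (simp add: card_image)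
    moreover have "F = (\<Union>y\<in>snd ` H. derangements_at n x y)" using row(2) F by simp
    ultimately show ?thesis by blast
  next
    case column
    have "y \<in> {1..n}" "fst ` H \<subseteq> {1..n} - {y}" using column H(1,3) by fastforce+
    moreover have "inj_on fst H" using column(2) by (metis inj_onI prod_eqI)
    then have "card (fst ` H) = s - 1" using H(2) by (simp add: card_image)
    moreover have "F = (\<Union>x\<in>fst ` H. derangements_at n x y)" using column(2) F by simp
    ultimately show ?thesis by blast
  qed
qed

theorem extremal_family:
  assumes "card F = (s - 1) * d1 n"
  shows "(\<exists>x ys. x \<in> {1..n} \<and> inj_on ys {1..s - 1} \<and>
            (\<forall>i\<in>{1..s - 1}. ys i \<in> {1..n} \<and> ys i \<noteq> x) \<and>
            F = (\<Union>i\<in>{1..s - 1}. derangements_at n x (ys i)))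
      \<or> (\<exists>y xs. y \<in> {1..n} \<and> inj_on xs {1..s - 1} \<and>
            (\<forall>i\<in>{1..s - 1}. xs i \<in> {1..n} \<and> xs i \<noteq> y) \<and>
            F = (\<Union>i\<in>{1..s - 1}. derangements_at n (xs i) y))"
proof -
  consider
    (row) x Y where "x \<in> {1..n}" "Y \<subseteq> {1..n} - {x}" "card Y = s - 1"
      "F = (\<Union>y\<in>Y. derangements_at n x y)"
    | (column) y X where "y \<in> {1..n}" "X \<subseteq> {1..n} - {y}" "card X = s - 1"
      "F = (\<Union>x\<in>X. derangements_at n x y)"
    using extremal_family_centres[OF assms] by blast
  then show ?thesis
  proof cases
    case row
    obtain ys where "inj_on ys {1..s - 1}" "\<forall>i\<in>{1..s - 1}. ys i \<in> {1..n} \<and> ys i \<noteq> x"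
      "(\<Union>y\<in>Y. derangements_at n x y) = (\<Union>i\<in>{1..s - 1}. derangements_at n x (ys i))"
      by (rule obtain_enumeration_UN[OF _ row(2,3)]) simp
    then show ?thesis using row(1,4) by (intro disjI1 exI[of _ x] exI[of _ ys]) simp
  next
    case column
    obtain xs where "inj_on xs {1..s - 1}" "\<forall>i\<in>{1..s - 1}. xs i \<in> {1..n} \<and> xs i \<noteq> y"
      "(\<Union>x\<in>X. derangements_at n x y) = (\<Union>i\<in>{1..s - 1}. derangements_at n (xs i) y)"
      by (rule obtain_enumeration_UN[OF _ column(2,3)]) simp
    then show ?thesis using column(1,4) by (intro disjI2 exI[of _ y] exI[of _ xs]) simp
  qed
qed

end

theorem theorem5:
  fixes n :: nat and s :: int and F :: "(nat \<Rightarrow> nat) set"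
  assumes hs: "real_of_int s \<le> real n / (2 ^ 17 * ln (real n))"
    and hF: "F \<subseteq> derangements n"
    and hnu: "int (nu n F) < s"
  shows "int (card F) \<le> (s - 1) * int (d1 n)
    \<and> (int (card F) = (s - 1) * int (d1 n) \<longrightarrow>
        (\<exists>x ys. x \<in> {1..n} \<and> inj_on ys {1..nat (s - 1)} \<and>
            (\<forall>i\<in>{1..nat (s - 1)}. ys i \<in> {1..n} \<and> ys i \<noteq> x) \<and>
            F = (\<Union>i\<in>{1..nat (s - 1)}. derangements_at n x (ys i)))
      \<or> (\<exists>y xs. y \<in> {1..n} \<and> inj_on xs {1..nat (s - 1)} \<and>
            (\<forall>i\<in>{1..nat (s - 1)}. xs i \<in> {1..n} \<and> xs i \<noteq> y) \<and>
            F = (\<Union>i\<in>{1..nat (s - 1)}. derangements_at n (xs i) y)))"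
proof -
  interpret derangement_family n "nat s" F
    using hs hF hnu by unfold_locales auto
  have s_minus_1: "s - 1 = int (nat s - 1)" "nat (s - 1) = nat s - 1" using s_pos by auto
  have "int (card F) \<le> (s - 1) * int (d1 n)"
    unfolding s_minus_1(1) using card_F_le by (metis of_nat_le_iff of_nat_mult)
  moreover have "int (card F) = (s - 1) * int (d1 n) \<longleftrightarrow> card F = (nat s - 1) * d1 n"
    unfolding s_minus_1(1) by (metis of_nat_eq_iff of_nat_mult)
  ultimately show ?thesis unfolding s_minus_1(2) using extremal_family by blast
qed

end
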